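(* Let $G$ be a MIF group and let $u\in \mathrm{PU}(LG)$ with $0<\bar\ell(u)<1/\sqrt2$. Then the subgroup $\langle u,G\rangle\subset \mathrm{PU}(LG)$ is not discrete. In particular, for every MIF group $G$, the set of discrete subgroups of $\mathrm{PU}(LG)$ containing $G$ is uniformly discrete.
   Context: A mixed identity for a group $G$ is a word $w\in\mathbb Z*G=\langle G,t\rangle$ in one variable $t$ with coefficients in $G$ which evaluates to the identity whenever any element of $G$ is substituted for $t$. $G$ is mixed identity free (MIF) if it satisfies no non-trivial mixed identity, i.e. for every $w\in(\mathbb Z*G)\setminus\{1\}$ there is $g\in G$ with $w(g)\neq1$. $LG$ is the group von Neumann algebra of $G$ with its canonical trace $\tau$; $\|x\|_2=\tau(x^*x)^{1/2}$. $\mathrm{U}(LG)$ is its unitary group and $\mathrm{PU}(LG)=\mathrm{U}(LG)/S^1$ its projective unitary group. For MIF $G$, the left regular representation gives a natural inclusion $G\subset \mathrm{PU}(LG)$. For a unitary $u\in \mathrm{U}(LG)$, $\bar\ell(u)=\inf_{|\lambda|=1}\|\lambda-u\|_2=\sqrt{2(1-|\tau(u)|)}$; this depends only on the class of $u$ in $\mathrm{PU}(LG)$ and metrizes $\mathrm{PU}(LG)$ via $d(u,v)=\bar\ell(u^{*}v)$; discreteness refers to this topology. A set of subgroups is uniformly discrete if there is a neighbourhood of the identity (equivalently, a constant $c>0$ and the ball $\{\bar\ell<c\}$) that meets each of these subgroups only in the identity. *)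

theory Defs
  imports "HOL-Analysis.Analysis" "HOL-Algebra.Elementary_Groups"
begin

section \<open>Free products and mixed identities\<close>

text \<open>The free product of \<open>G\<close> and \<open>H\<close> is the monoid of words over the disjoint union of the
  carriers, modulo the congruence generated by deleting identity letters and multiplying
  adjacent letters from the same factor.\<close>

inductive_set free_product_rel ::
  "('a, 'm) monoid_scheme \<Rightarrow> ('b, 'n) monoid_scheme \<Rightarrow> (('a + 'b) list \<times> ('a + 'b) list) set"
  for G (structure) and H (structure) where
  refl: "w \<in> lists (carrier G <+> carrier H) \<Longrightarrow> (w, w) \<in> free_product_rel G H"
| sym: "(v, w) \<in> free_product_rel G H \<Longrightarrow> (w, v) \<in> free_product_rel G H"
| trans: "(u, v) \<in> free_product_rel G H \<Longrightarrow> (v, w) \<in> free_product_rel G H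
    \<Longrightarrow> (u, w) \<in> free_product_rel G H"
| cong: "(v, w) \<in> free_product_rel G H \<Longrightarrow> x \<in> lists (carrier G <+> carrier H)
    \<Longrightarrow> y \<in> lists (carrier G <+> carrier H) \<Longrightarrow> (x @ v @ y, x @ w @ y) \<in> free_product_rel G H"
| one_left: "([Inl \<one>\<^bsub>G\<^esub>], []) \<in> free_product_rel G H"
| one_right: "([Inr \<one>\<^bsub>H\<^esub>], []) \<in> free_product_rel G H"
| mult_left: "a \<in> carrier G \<Longrightarrow> b \<in> carrier G
    \<Longrightarrow> ([Inl a, Inl b], [Inl (a \<otimes>\<^bsub>G\<^esub> b)]) \<in> free_product_rel G H"
| mult_right: "a \<in> carrier H \<Longrightarrow> b \<in> carrier H
    \<Longrightarrow> ([Inr a, Inr b], [Inr (a \<otimes>\<^bsub>H\<^esub> b)]) \<in> free_product_rel G H"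

definition free_product ::
  "('a, 'm) monoid_scheme \<Rightarrow> ('b, 'n) monoid_scheme \<Rightarrow> ('a + 'b) list set monoid" where
  "free_product G H =
    \<lparr>carrier = lists (carrier G <+> carrier H) // free_product_rel G H,
     mult = (\<lambda>A B. \<Union>a\<in>A. \<Union>b\<in>B. free_product_rel G H `` {a @ b}),
     one = free_product_rel G H `` {[]}\<rparr>"

text \<open>In \<open>free_product integer_group G\<close> the letter \<open>Inl n\<close> stands for the power \<open>t\<^sup>n\<close> of the
  variable and \<open>Inr a\<close> for the coefficient \<open>a\<close>; \<open>list_subst G g\<close> substitutes \<open>g\<close> for \<open>t\<close>.\<close>

fun list_subst :: "('a, 'm) monoid_scheme \<Rightarrow> 'a \<Rightarrow> (int + 'a) list \<Rightarrow> 'a" where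
  "list_subst G g [] = \<one>\<^bsub>G\<^esub>"
| "list_subst G g (Inl n # w) = (g [^]\<^bsub>G\<^esub> n) \<otimes>\<^bsub>G\<^esub> list_subst G g w"
| "list_subst G g (Inr a # w) = a \<otimes>\<^bsub>G\<^esub> list_subst G g w"

definition mixed_subst :: "('a, 'm) monoid_scheme \<Rightarrow> 'a \<Rightarrow> (int + 'a) list set \<Rightarrow> 'a" where
  "mixed_subst G g W = the_elem (list_subst G g ` W)"

definition mixed_identity :: "('a, 'm) monoid_scheme \<Rightarrow> (int + 'a) list set \<Rightarrow> bool" where
  "mixed_identity G W \<longleftrightarrow> W \<in> carrier (free_product integer_group G) \<and>
    (\<forall>g \<in> carrier G. mixed_subst G g W = \<one>\<^bsub>G\<^esub>)"

definition MIF :: "('a, 'm) monoid_scheme \<Rightarrow> bool" where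
  "MIF G \<longleftrightarrow> group G \<and> (\<forall>W. mixed_identity G W \<longrightarrow> W = \<one>\<^bsub>free_product integer_group G\<^esub>)"

context group
begin

lemma list_subst_closed:
  assumes "g \<in> carrier G" "w \<in> lists (carrier integer_group <+> carrier G)"
  shows "list_subst G g w \<in> carrier G"
  using assms(2) by (induction w) (use assms(1) in auto)

lemma list_subst_append:
  assumes g: "g \<in> carrier G" and v: "v \<in> lists (carrier integer_group <+> carrier G)"
    and w: "w \<in> lists (carrier integer_group <+> carrier G)"
  shows "list_subst G g (v @ w) = list_subst G g v \<otimes> list_subst G g w"
  using v
proof (induction v)
  case (Cons l v)
  have "list_subst G g v \<in> carrier G" "list_subst G g w \<in> carrier G"
    using list_subst_closed[OF g] Cons.hyps w by blast+
  with Cons g show ?case by (cases l) (auto simp: m_assoc)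
qed (use list_subst_closed[OF g w] in simp)

lemma free_product_rel_lists:
  assumes "monoid K" "(v, w) \<in> free_product_rel K G"
  shows "v \<in> lists (carrier K <+> carrier G) \<and> w \<in> lists (carrier K <+> carrier G)"
  using assms(2)
  by induction (auto simp: monoid.one_closed[OF assms(1)] monoid.m_closed[OF assms(1)])

lemma list_subst_cong:
  assumes g: "g \<in> carrier G" and "(v, w) \<in> free_product_rel integer_group G"
  shows "list_subst G g v = list_subst G g w"
  using assms(2)
proof induction
  case (cong v w x y)
  have "v \<in> lists (carrier integer_group <+> carrier G)"
    "w \<in> lists (carrier integer_group <+> carrier G)"
    using cong.hyps(1) free_product_rel_lists[OF group.is_monoid[OF group_integer_group]] by blast+
  with cong show ?case
    by (simp only: list_subst_append[OF g] append_in_lists_conv simp_thms)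
next
  case (mult_left a b)
  then show ?case using g by (simp add: int_pow_mult)
qed (use g in auto)

lemma mixed_subst_class:
  assumes "g \<in> carrier G" "w \<in> lists (carrier integer_group <+> carrier G)"
  shows "mixed_subst G g (free_product_rel integer_group G `` {w}) = list_subst G g w"
proof -
  let ?R = "free_product_rel integer_group G"
  have "w \<in> ?R `` {w}" using free_product_rel.refl[OF assms(2)] by simp
  moreover have "list_subst G g v = list_subst G g w" if "v \<in> ?R `` {w}" for v
    using list_subst_cong[OF assms(1), of w v] that by simp
  ultimately have "list_subst G g ` (?R `` {w}) = {list_subst G g w}" by blast
  then show ?thesis by (simp add: mixed_subst_def)
qed

end


section \<open>Bounded operators on \<open>\<ell>\<^sup>2(S)\<close>\<close>

definition ell2 :: "'a set \<Rightarrow> ('a \<Rightarrow> complex) set" where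
  "ell2 S = {f. (\<forall>x. x \<notin> S \<longrightarrow> f x = 0) \<and> (\<lambda>x. (cmod (f x))\<^sup>2) summable_on S}"

definition ell2_inner :: "'a set \<Rightarrow> ('a \<Rightarrow> complex) \<Rightarrow> ('a \<Rightarrow> complex) \<Rightarrow> complex" where
  "ell2_inner S f g = (\<Sum>\<^sub>\<infinity>x\<in>S. f x * cnj (g x))"

definition ell2_norm :: "'a set \<Rightarrow> ('a \<Rightarrow> complex) \<Rightarrow> real" where
  "ell2_norm S f = sqrt (\<Sum>\<^sub>\<infinity>x\<in>S. (cmod (f x))\<^sup>2)"

text \<open>Operators are taken extensional (\<open>undefined\<close> off \<open>ell2 S\<close>), so that equality of operators is
  equality in HOL; they are composed with \<^const>\<open>compose\<close>.\<close>

definition bounded_ops :: "'a set \<Rightarrow> (('a \<Rightarrow> complex) \<Rightarrow> ('a \<Rightarrow> complex)) set" where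
  "bounded_ops S = {T \<in> ell2 S \<rightarrow>\<^sub>E ell2 S.
     (\<forall>f\<in>ell2 S. \<forall>g\<in>ell2 S. T (\<lambda>x. f x + g x) = (\<lambda>x. T f x + T g x)) \<and>
     (\<forall>c. \<forall>f\<in>ell2 S. T (\<lambda>x. c * f x) = (\<lambda>x. c * T f x)) \<and>
     (\<exists>C. \<forall>f\<in>ell2 S. ell2_norm S (T f) \<le> C * ell2_norm S f)}"

definition adjoint_op ::
  "'a set \<Rightarrow> (('a \<Rightarrow> complex) \<Rightarrow> ('a \<Rightarrow> complex)) \<Rightarrow> (('a \<Rightarrow> complex) \<Rightarrow> ('a \<Rightarrow> complex))" where
  "adjoint_op S T = (THE R. R \<in> bounded_ops S \<and>
     (\<forall>f\<in>ell2 S. \<forall>g\<in>ell2 S. ell2_inner S (T f) g = ell2_inner S f (R g)))"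

definition scalar_op :: "'a set \<Rightarrow> complex \<Rightarrow> ('a \<Rightarrow> complex) \<Rightarrow> ('a \<Rightarrow> complex)" where
  "scalar_op S c = (\<lambda>f\<in>ell2 S. \<lambda>x. c * f x)"

definition minus_op ::
  "'a set \<Rightarrow> (('a \<Rightarrow> complex) \<Rightarrow> ('a \<Rightarrow> complex)) \<Rightarrow> (('a \<Rightarrow> complex) \<Rightarrow> ('a \<Rightarrow> complex))
    \<Rightarrow> ('a \<Rightarrow> complex) \<Rightarrow> ('a \<Rightarrow> complex)" where
  "minus_op S T R = (\<lambda>f\<in>ell2 S. \<lambda>x. T f x - R f x)"

definition commutant ::
  "'a set \<Rightarrow> (('a \<Rightarrow> complex) \<Rightarrow> ('a \<Rightarrow> complex)) set \<Rightarrow> (('a \<Rightarrow> complex) \<Rightarrow> ('a \<Rightarrow> complex)) set" where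
  "commutant S M = {T \<in> bounded_ops S. \<forall>R\<in>M. compose (ell2 S) T R = compose (ell2 S) R T}"


section \<open>The group von Neumann algebra\<close>

definition left_reg ::
  "('a, 'm) monoid_scheme \<Rightarrow> 'a \<Rightarrow> ('a \<Rightarrow> complex) \<Rightarrow> ('a \<Rightarrow> complex)" where
  "left_reg G g = (\<lambda>f\<in>ell2 (carrier G). \<lambda>x. if x \<in> carrier G then f (inv\<^bsub>G\<^esub> g \<otimes>\<^bsub>G\<^esub> x) else 0)"

text \<open>The von Neumann algebra generated by the left regular representation, as its bicommutant.\<close>

definition LG :: "('a, 'm) monoid_scheme \<Rightarrow> (('a \<Rightarrow> complex) \<Rightarrow> ('a \<Rightarrow> complex)) set" where
  "LG G = commutant (carrier G) (commutant (carrier G) (left_reg G ` carrier G))"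

definition delta_one :: "('a, 'm) monoid_scheme \<Rightarrow> 'a \<Rightarrow> complex" where
  "delta_one G = (\<lambda>x. if x = \<one>\<^bsub>G\<^esub> then 1 else 0)"

definition trace_LG ::
  "('a, 'm) monoid_scheme \<Rightarrow> (('a \<Rightarrow> complex) \<Rightarrow> ('a \<Rightarrow> complex)) \<Rightarrow> complex" where
  "trace_LG G T = ell2_inner (carrier G) (T (delta_one G)) (delta_one G)"

definition norm2_LG ::
  "('a, 'm) monoid_scheme \<Rightarrow> (('a \<Rightarrow> complex) \<Rightarrow> ('a \<Rightarrow> complex)) \<Rightarrow> real" where
  "norm2_LG G T =
    sqrt (Re (trace_LG G (compose (ell2 (carrier G)) (adjoint_op (carrier G) T) T)))"

definition U_LG ::
  "('a, 'm) monoid_scheme \<Rightarrow> (('a \<Rightarrow> complex) \<Rightarrow> ('a \<Rightarrow> complex)) monoid" where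
  "U_LG G =
    \<lparr>carrier = {u \<in> LG G.
       compose (ell2 (carrier G)) (adjoint_op (carrier G) u) u = scalar_op (carrier G) 1 \<and>
       compose (ell2 (carrier G)) u (adjoint_op (carrier G) u) = scalar_op (carrier G) 1},
     mult = compose (ell2 (carrier G)),
     one = scalar_op (carrier G) 1\<rparr>"

definition ell_bar ::
  "('a, 'm) monoid_scheme \<Rightarrow> (('a \<Rightarrow> complex) \<Rightarrow> ('a \<Rightarrow> complex)) \<Rightarrow> real" where
  "ell_bar G u =
    (INF c \<in> {c :: complex. cmod c = 1}. norm2_LG G (minus_op (carrier G) (scalar_op (carrier G) c) u))"


section \<open>The projective unitary group\<close>

definition circle_LG ::
  "('a, 'm) monoid_scheme \<Rightarrow> (('a \<Rightarrow> complex) \<Rightarrow> ('a \<Rightarrow> complex)) set" where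
  "circle_LG G = scalar_op (carrier G) ` {c. cmod c = 1}"

definition PU_LG ::
  "('a, 'm) monoid_scheme \<Rightarrow> (('a \<Rightarrow> complex) \<Rightarrow> ('a \<Rightarrow> complex)) set monoid" where
  "PU_LG G = U_LG G Mod circle_LG G"

definition PU_embed ::
  "('a, 'm) monoid_scheme \<Rightarrow> 'a \<Rightarrow> (('a \<Rightarrow> complex) \<Rightarrow> ('a \<Rightarrow> complex)) set" where
  "PU_embed G g = circle_LG G #>\<^bsub>U_LG G\<^esub> left_reg G g"

text \<open>\<^const>\<open>ell_bar\<close> is constant on the elements of \<open>PU_LG G\<close>, which are cosets of the circle.\<close>

definition PU_ell_bar ::
  "('a, 'm) monoid_scheme \<Rightarrow> (('a \<Rightarrow> complex) \<Rightarrow> ('a \<Rightarrow> complex)) set \<Rightarrow> real" where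
  "PU_ell_bar G A = the_elem (ell_bar G ` A)"

text \<open>The locale \<^locale>\<open>Metric_space\<close> asks for a function that is nonnegative and symmetric on the
  whole type, hence the value \<open>0\<close> off the carrier.\<close>

definition PU_dist ::
  "('a, 'm) monoid_scheme \<Rightarrow> (('a \<Rightarrow> complex) \<Rightarrow> ('a \<Rightarrow> complex)) set
    \<Rightarrow> (('a \<Rightarrow> complex) \<Rightarrow> ('a \<Rightarrow> complex)) set \<Rightarrow> real" where
  "PU_dist G A B =
    (if A \<in> carrier (PU_LG G) \<and> B \<in> carrier (PU_LG G)
     then PU_ell_bar G (inv\<^bsub>PU_LG G\<^esub> A \<otimes>\<^bsub>PU_LG G\<^esub> B) else 0)"

definition PU_topology ::
  "('a, 'm) monoid_scheme \<Rightarrow> (('a \<Rightarrow> complex) \<Rightarrow> ('a \<Rightarrow> complex)) set topology" where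
  "PU_topology G = Metric_space.mtopology (carrier (PU_LG G)) (PU_dist G)"

definition PU_discrete ::
  "('a, 'm) monoid_scheme \<Rightarrow> (('a \<Rightarrow> complex) \<Rightarrow> ('a \<Rightarrow> complex)) set set \<Rightarrow> bool" where
  "PU_discrete G H \<longleftrightarrow> subtopology (PU_topology G) H = discrete_topology H"

definition PU_uniformly_discrete ::
  "('a, 'm) monoid_scheme \<Rightarrow> (('a \<Rightarrow> complex) \<Rightarrow> ('a \<Rightarrow> complex)) set set set \<Rightarrow> bool" where
  "PU_uniformly_discrete G \<H> \<longleftrightarrow>
    (\<exists>U. openin (PU_topology G) U \<and> \<one>\<^bsub>PU_LG G\<^esub> \<in> U \<and> (\<forall>H\<in>\<H>. H \<inter> U = {\<one>\<^bsub>PU_LG G\<^esub>}))"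

end

theory Submission
  imports Defs
begin

text \<open>
  Write \<open>\<tau>\<close> for the trace, \<open>\<delta>\<close> for the point mass at the identity and \<open>\<lambda>\<^sub>g\<close> for left translation.
  The proof rests on one asymptotic formula: if \<open>u\<close> is a unitary of the group von Neumann algebra
  of a MIF group and \<open>v = \<lambda>\<^sub>g u \<lambda>\<^sub>g\<^sup>*\<close> for a sufficiently generic group element \<open>g\<close>, then
  \<open>\<tau>(u v u\<^sup>* v\<^sup>*)\<close> is as close as desired to \<open>1 - (1 - \<bar>\<tau>(u)\<bar>\<^sup>2)\<^sup>2\<close>, which is the value it would have if
  \<open>u\<close> and \<open>v\<close> were free. With \<open>s = 1 - \<bar>\<tau>(u)\<bar>\<close>, half the square of the length of \<open>u\<close>, the commutator thus
  has the parameter \<open>s' \<approx> s\<^sup>2 (2 - s)\<^sup>2\<close>, which lies strictly between \<open>0\<close> and \<open>4 s\<^sup>2\<close> when \<open>0 < s < 1\<close>. The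
  condition that the length is below \<open>1/sqrt 2\<close> says \<open>4 s < 1\<close>, and \<open>4 s' < (4 s)\<^sup>2\<close>, so iterated commutators with
  generic conjugates stay in the subgroup, never become trivial, and have lengths tending to \<open>0\<close>:
  \<open>exists_shorter_commutator\<close> and \<open>not_PU_discrete_if_short\<close>. Applied to an arbitrary subgroup
  containing \<open>G\<close>, this also shows that the ball of radius \<open>1/sqrt 2\<close> meets every such discrete
  subgroup in the identity only.

  The formula, \<open>trace_generic_commutator\<close>, is obtained from vectors. The trace equals
  \<open>\<langle>u\<^sup>*v\<^sup>*\<delta>, v\<^sup>*u\<^sup>*\<delta>\<rangle>\<close>. Put \<open>\<xi> = u\<^sup>*\<delta>\<close>; then \<open>v\<^sup>*\<delta>\<close> is \<open>\<xi>\<close> moved by conjugation with \<open>g\<close>. Operators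
  of the algebra commute with right translations, so up to small errors that do not depend on \<open>g\<close> the two vectors are
  \<open>\<Sum> \<xi>(k) \<xi>(a) \<delta>\<^sub>x\<close> with \<open>x = a g k g\<^sup>-\<^sup>1\<close>, and \<open>\<Sum> \<xi>(d) \<xi>(c) \<delta>\<^sub>y\<close> with \<open>y = g c g\<^sup>-\<^sup>1 d\<close>, for indices
  in finite sets. It remains to know when \<open>x = y\<close>. In the free product \<open>a t k t\<^sup>-\<^sup>1 = t c t\<^sup>-\<^sup>1 d\<close> holds only
  if \<open>k = c = 1\<close> and \<open>a = d\<close>, or \<open>a = d = 1\<close> and \<open>k = c\<close>, and \<open>MIF_exists_conjugator\<close> provides a \<open>g\<close> for
  which the finitely many instances at hand have no other coincidences. The two families of coincidences
  contribute \<open>\<bar>\<tau>(u)\<bar>\<^sup>2\<close> each, and their overlap \<open>\<bar>\<tau>(u)\<bar>\<^sup>4\<close> is counted once.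
\<close>

section \<open>Generic elements of groups without mixed identities\<close>

text \<open>Left multiplication of a reduced word by one letter, with cancellation at the front only.\<close>

fun lmul_nf :: "('a, 'm) monoid_scheme \<Rightarrow> int + 'a \<Rightarrow> (int + 'a) list \<Rightarrow> (int + 'a) list" where
  "lmul_nf G (Inl n) (Inl m # w) = (if n + m = 0 then w else Inl (n + m) # w)"
| "lmul_nf G (Inl n) w = (if n = 0 then w else Inl n # w)"
| "lmul_nf G (Inr a) (Inr b # w) = (if a \<otimes>\<^bsub>G\<^esub> b = \<one>\<^bsub>G\<^esub> then w else Inr (a \<otimes>\<^bsub>G\<^esub> b) # w)"
| "lmul_nf G (Inr a) w = (if a = \<one>\<^bsub>G\<^esub> then w else Inr a # w)"

abbreviation nf :: "('a, 'm) monoid_scheme \<Rightarrow> (int + 'a) list \<Rightarrow> (int + 'a) list" where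
  "nf G w \<equiv> foldr (lmul_nf G) w []"

definition reduced :: "('a, 'm) monoid_scheme \<Rightarrow> (int + 'a) list \<Rightarrow> bool" where
  "reduced G w \<longleftrightarrow> set w \<subseteq> Inl ` (- {0}) \<union> Inr ` (carrier G - {\<one>\<^bsub>G\<^esub>}) \<and>
     successively (\<lambda>l l'. isl l \<noteq> isl l') w"

abbreviation mixed_words :: "('a, 'm) monoid_scheme \<Rightarrow> (int + 'a) list set" where
  "mixed_words G \<equiv> lists (carrier integer_group <+> carrier G)"

lemma reduced_Nil [simp]: "reduced G []"
  by (simp add: reduced_def)

lemma reduced_Cons:
  "reduced G (l # w) \<longleftrightarrow> l \<in> Inl ` (- {0}) \<union> Inr ` (carrier G - {\<one>\<^bsub>G\<^esub>}) \<and>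
     (w = [] \<or> isl l \<noteq> isl (hd w)) \<and> reduced G w"
  by (auto simp: reduced_def successively_Cons)

lemma reduced_append:
  "reduced G (v @ w) \<longleftrightarrow> reduced G v \<and> reduced G w \<and>
     (v = [] \<or> w = [] \<or> isl (last v) \<noteq> isl (hd w))"
  by (auto simp: reduced_def successively_append_iff)

lemma reduced_mixed_words: "reduced G w \<Longrightarrow> w \<in> mixed_words G"
  by (auto simp: reduced_def in_lists_conv_set)

context group
begin

lemma reduced_lmul_nf:
  assumes "l \<in> carrier integer_group <+> carrier G" "reduced G w"
  shows "reduced G (lmul_nf G l w)"
  using assms by (cases "(G, l, w)" rule: lmul_nf.cases) (auto simp: reduced_Cons)

lemma reduced_foldr_lmul_nf:
  assumes "v \<in> mixed_words G" "reduced G w"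
  shows "reduced G (foldr (lmul_nf G) v w)"
  using assms by (induction v) (auto intro: reduced_lmul_nf)

lemma lmul_nf_Inl_plain:
  "w = [] \<or> \<not> isl (hd w) \<Longrightarrow> lmul_nf G (Inl n) w = (if n = 0 then w else Inl n # w)"
  by (cases "(G, Inl n :: int + 'a, w)" rule: lmul_nf.cases) auto

lemma lmul_nf_Inr_plain:
  "w = [] \<or> isl (hd w) \<Longrightarrow> lmul_nf G (Inr a) w = (if a = \<one> then w else Inr a # w)"
  by (cases "(G, Inr a :: int + 'a, w)" rule: lmul_nf.cases) auto

text \<open>This and its analogue for coefficients say that each factor of the free product acts on reduced
  words.\<close>

lemma lmul_nf_Inl:
  assumes "reduced G w"
  shows "lmul_nf G (Inl n) (lmul_nf G (Inl m) w) = lmul_nf G (Inl (n + m)) w"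
  using assms
  by (cases "(G, Inl m :: int + 'a, w)" rule: lmul_nf.cases)
     (auto simp: reduced_Cons lmul_nf_Inl_plain add.assoc)

lemma lmul_nf_Inr:
  assumes "reduced G w" "a \<in> carrier G" "b \<in> carrier G"
  shows "lmul_nf G (Inr a) (lmul_nf G (Inr b) w) = lmul_nf G (Inr (a \<otimes> b)) w"
proof (cases "(G, Inr b :: int + 'a, w)" rule: lmul_nf.cases)
  case (3 G' b' c v)
  then have c: "c \<in> carrier G" "w = Inr c # v" "v = [] \<or> isl (hd v)"
    using assms by (auto simp: reduced_Cons)
  have "a \<otimes> (b \<otimes> c) = a" if "b \<otimes> c = \<one>" using that assms by simp
  then show ?thesis
    using c assms by (auto simp: lmul_nf_Inr_plain m_assoc)
qed (use assms in \<open>auto simp: m_assoc\<close>)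

text \<open>Normal forms are unique by van der Waerden's argument: left multiplication by letters is an action
  of the free product on reduced words, so equivalent words act equally.\<close>

lemma foldr_lmul_nf_cong:
  assumes "(v, w) \<in> free_product_rel integer_group G" "reduced G x"
  shows "foldr (lmul_nf G) v x = foldr (lmul_nf G) w x"
  using assms
proof (induction arbitrary: x)
  case (cong v w p q)
  then show ?case by (simp add: reduced_foldr_lmul_nf)
next
  case one_left
  then show ?case by (cases "(G, Inl 0 :: int + 'a, x)" rule: lmul_nf.cases) (auto simp: reduced_Cons)
next
  case one_right
  then show ?case by (cases "(G, Inr \<one> :: int + 'a, x)" rule: lmul_nf.cases) (auto simp: reduced_Cons)
next
  case (mult_left a b)
  then show ?case by (simp add: lmul_nf_Inl)
next
  case (mult_right a b)
  then show ?case by (simp add: lmul_nf_Inr)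
qed auto

lemma Cons_equiv_lmul_nf:
  assumes "l \<in> carrier integer_group <+> carrier G" "reduced G w"
  shows "(l # w, lmul_nf G l w) \<in> free_product_rel integer_group G"
proof -
  let ?R = "free_product_rel integer_group G"
  note refl = free_product_rel.refl[of _ integer_group G]
  have w: "w \<in> mixed_words G" by (rule reduced_mixed_words) fact
  have l: "l # w \<in> mixed_words G" using assms(1) w by simp
  have pre: "(x @ w, y @ w) \<in> ?R" if "(x, y) \<in> ?R" "w \<in> mixed_words G" for x y w
    using free_product_rel.cong[OF that(1), of "[]" w] that(2) by simp
  show ?thesis
  proof (cases "(G, l, w)" rule: lmul_nf.cases)
    case (1 G' n m v)
    have "([Inl n, Inl m], [Inl (n + m)]) \<in> ?R"
      using free_product_rel.mult_left[of n integer_group m G] by simp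
    moreover have "(Inl 0 # v, v) \<in> ?R"
      using pre[OF free_product_rel.one_left, of v] 1 w by simp
    ultimately show ?thesis
      using pre[of "[Inl n, Inl m]" "[Inl (n + m)]" v] 1 w
      by (auto intro: free_product_rel.trans)
  next
    case (3 G' a b v)
    have "([Inr a, Inr b], [Inr (a \<otimes> b)]) \<in> ?R"
      using free_product_rel.mult_right[of a G b integer_group] 3 assms by (auto simp: reduced_Cons)
    moreover have "(Inr \<one> # v, v) \<in> ?R"
      using pre[OF free_product_rel.one_right, of v] 3 w by simp
    ultimately show ?thesis
      using pre[of "[Inr a, Inr b]" "[Inr (a \<otimes> b)]" v] 3 w
      by (auto intro: free_product_rel.trans)
  qed (use pre[OF free_product_rel.one_left, of w] pre[OF free_product_rel.one_right, of w] refl[OF l] w in auto)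
qed

lemma equiv_nf:
  assumes "w \<in> mixed_words G"
  shows "(w, nf G w) \<in> free_product_rel integer_group G"
  using assms
proof (induction w)
  case Nil
  then show ?case using free_product_rel.refl[of "[]"] by simp
next
  case (Cons l w)
  have "([l] @ w @ [], [l] @ nf G w @ []) \<in> free_product_rel integer_group G"
    using Cons by (intro free_product_rel.cong) auto
  moreover have "(l # nf G w, lmul_nf G l (nf G w)) \<in> free_product_rel integer_group G"
    using Cons by (intro Cons_equiv_lmul_nf reduced_foldr_lmul_nf) auto
  ultimately show ?case using free_product_rel.trans by fastforce
qed

lemma lmul_nf_reduced: "reduced G (l # w) \<Longrightarrow> lmul_nf G l w = l # w"
  by (cases l) (auto simp: reduced_Cons lmul_nf_Inl_plain lmul_nf_Inr_plain)

lemma nf_reduced: "reduced G w \<Longrightarrow> nf G w = w"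
  by (induction w) (simp_all add: lmul_nf_reduced, simp add: reduced_Cons lmul_nf_reduced)

text \<open>A reduced word is its own normal form, so a nonempty one is a nontrivial element of the free
  product and the MIF property applies to it.\<close>

lemma nontrivial_reduced_evaluation:
  assumes "MIF G" "reduced G w" "w \<noteq> []"
  shows "\<exists>g\<in>carrier G. list_subst G g w \<noteq> \<one>"
proof (rule ccontr)
  let ?R = "free_product_rel integer_group G"
  assume *: "\<not> ?thesis"
  have w: "w \<in> mixed_words G" using assms(2) by (rule reduced_mixed_words)
  have "mixed_identity G (?R `` {w})"
    using * w mixed_subst_class[OF _ w]
    by (auto simp: mixed_identity_def free_product_def intro: quotientI)
  then have "?R `` {w} = ?R `` {[]}"
    using assms(1) by (auto simp: MIF_def free_product_def)
  moreover have "[] \<in> ?R `` {[]}" using free_product_rel.refl[of "[]"] by simp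
  ultimately have "(w, []) \<in> ?R" by blast
  from foldr_lmul_nf_cong[OF this, of "[]"] have "nf G w = []" by simp
  then show False using assms by (simp add: nf_reduced)
qed

fun inv_letter :: "int + 'a \<Rightarrow> int + 'a" where
  "inv_letter (Inl n) = Inl (- n)"
| "inv_letter (Inr a) = Inr (inv a)"

definition inv_word :: "(int + 'a) list \<Rightarrow> (int + 'a) list" where
  "inv_word w = rev (map inv_letter w)"

lemma inv_letter_closed:
  "l \<in> carrier integer_group <+> carrier G \<Longrightarrow> inv_letter l \<in> carrier integer_group <+> carrier G"
  by (cases l) auto

lemma isl_inv_letter [simp]: "isl (inv_letter l) = isl l"
  by (cases l) auto

lemma reduced_inv_word: "reduced G w \<Longrightarrow> reduced G (inv_word w)"
proof (induction w)
  case (Cons l w)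
  then show ?case
    by (cases l) (cases "w = []"; auto simp: inv_word_def reduced_append reduced_Cons last_rev hd_map)+
qed (simp add: inv_word_def)

lemma list_subst_inv_word:
  assumes g: "g \<in> carrier G" and w: "w \<in> mixed_words G"
  shows "list_subst G g (inv_word w) = inv (list_subst G g w)"
  using w
proof (induction w)
  case (Cons l w)
  have *: "inv_word w \<in> mixed_words G" "[inv_letter l] \<in> mixed_words G" "list_subst G g w \<in> carrier G"
    using Cons.hyps list_subst_closed[OF g, of w] by (auto simp: inv_word_def simp del: carrier_integer_group intro!: inv_letter_closed)
  have "inv_word (l # w) = inv_word w @ [inv_letter l]" by (simp add: inv_word_def)
  then show ?case
    using list_subst_append[OF g *(1,2)] Cons * g
    by (cases l) (auto simp: inv_mult_group int_pow_neg)
qed (simp add: inv_word_def)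

text \<open>Words of this shape can be interleaved with nontrivial coefficients without any cancellation, and
  their inverses have the same shape. This makes them convenient for building commutators whose
  nontriviality is visible.\<close>

definition t_ended :: "(int + 'a) list \<Rightarrow> bool" where
  "t_ended w \<longleftrightarrow> reduced G w \<and> w \<noteq> [] \<and> isl (hd w) \<and> isl (last w)"

lemma cancel_inv:
  assumes "x \<in> carrier G" "y \<in> carrier G"
  shows "x \<otimes> (inv x \<otimes> y) = y" "inv x \<otimes> (x \<otimes> y) = y"
  using assms by (simp_all flip: m_assoc)

text \<open>Conjugation by a suitable power of the variable puts powers of it at both ends.\<close>

lemma exists_t_ended:
  assumes "reduced G w" "w \<noteq> []"
  shows "\<exists>w'. t_ended w' \<and> (\<forall>g\<in>carrier G. list_subst G g w = \<one> \<longrightarrow> list_subst G g w' = \<one>)"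
proof -
  have subst_cong: "list_subst G g (x @ y) = list_subst G g x \<otimes> list_subst G g y"
    "list_subst G g x \<in> carrier G"
    if "g \<in> carrier G" "reduced G x" "reduced G y" for g x y
    using that list_subst_append list_subst_closed reduced_mixed_words by blast+
  consider (both) "isl (hd w)" "isl (last w)" | (neither) "\<not> isl (hd w)" "\<not> isl (last w)"
    | (left) n v where "w = Inl n # v" "v \<noteq> []" "\<not> isl (last v)"
    | (right) m v where "w = v @ [Inl m]" "v \<noteq> []" "\<not> isl (hd v)"
  proof (cases "isl (hd w) = isl (last w)")
    case True
    then show ?thesis using both neither by blast
  next
    case False
    show ?thesis
    proof (cases "isl (hd w)")
      case True
      then obtain n v where v: "w = Inl n # v" using assms(2) by (cases w) (auto simp: isl_def)
      then show ?thesis using left[OF v] False by (cases "v = []") auto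
    next
      case f: False
      then have l: "isl (last w)" using False by simp
      have "w = butlast w @ [last w]" using assms(2) by simp
      then obtain m v where v: "w = v @ [Inl m]" using l by (metis isl_def)
      then show ?thesis using right[OF v] f by (cases "v = []") auto
    qed
  qed
  then show ?thesis
  proof cases
    case both
    then show ?thesis using assms by (auto simp: t_ended_def)
  next
    case neither
    have "t_ended (Inl 1 # w @ [Inl (- 1)])"
      using neither assms by (auto simp: t_ended_def reduced_Cons reduced_append)
    moreover have "list_subst G g (Inl 1 # w @ [Inl (- 1)]) = \<one>"
      if "g \<in> carrier G" "list_subst G g w = \<one>" for g
      using that subst_cong[of g w "[Inl (- 1)]"] assms by (simp add: reduced_Cons int_pow_neg)
    ultimately show ?thesis by blast
  next
    case (left n v)
    then have v: "reduced G v" "n \<noteq> 0" "\<not> isl (hd v)" using assms(1) by (auto simp: reduced_Cons)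
    \<comment> \<open>Conjugating by \<open>t\<^sup>n\<close> doubles the exponent in front, which therefore stays nonzero.\<close>
    have "t_ended (Inl (n + n) # v @ [Inl (- n)])"
      using left v by (auto simp: t_ended_def reduced_Cons reduced_append)
    moreover have "list_subst G g (Inl (n + n) # v @ [Inl (- n)]) = \<one>"
      if g: "g \<in> carrier G" and w: "list_subst G g w = \<one>" for g
    proof -
      have "list_subst G g v = inv (g [^] n)"
        using inv_solve_left[of "g [^] n" "list_subst G g v" \<one>] w left g v subst_cong(2)[of g v "[]"]
        by (simp add: inv_equality)
      moreover have "g [^] (n + n) = g [^] n \<otimes> g [^] n" using int_pow_mult g .
      ultimately show ?thesis
        using subst_cong[of g v "[Inl (- n)]"] g v
        by (simp add: reduced_Cons int_pow_neg m_assoc cancel_inv del: mult_2 mult_2_right)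
    qed
    ultimately show ?thesis by blast
  next
    case (right m v)
    then have v: "reduced G v" "m \<noteq> 0" "isl (last v) = False"
      using assms(1) by (auto simp: reduced_append reduced_Cons)
    have "t_ended (Inl (- m) # v @ [Inl (m + m)])"
      using right v by (auto simp: t_ended_def reduced_Cons reduced_append)
    moreover have "list_subst G g (Inl (- m) # v @ [Inl (m + m)]) = \<one>"
      if g: "g \<in> carrier G" and w: "list_subst G g w = \<one>" for g
    proof -
      have "list_subst G g v \<otimes> g [^] m = \<one>"
        using w subst_cong[of g v "[Inl m]"] right v g by (simp add: reduced_Cons)
      then have "list_subst G g v = inv (g [^] m)"
        using g v subst_cong(2)[of g v "[]"] by (metis int_pow_closed inv_equality reduced_Nil inv_inv)
      moreover have "g [^] (m + m) = g [^] m \<otimes> g [^] m" using int_pow_mult g .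
      ultimately show ?thesis
        using subst_cong[of g v "[Inl (m + m)]"] g v
        by (simp add: reduced_Cons int_pow_neg m_assoc cancel_inv del: mult_2 mult_2_right)
    qed
    ultimately show ?thesis by blast
  qed
qed

text \<open>A commutator is the identity wherever one of its two entries is. Hence a nontrivial commutator of
  conjugates of two words witnesses both of them being nontrivial at once.\<close>

lemma t_ended_common:
  assumes "t_ended v" "t_ended w" "a \<in> carrier G" "a \<noteq> \<one>"
  shows "\<exists>w'. t_ended w' \<and> (\<forall>g\<in>carrier G. list_subst G g v = \<one> \<or> list_subst G g w = \<one> \<longrightarrow>
      list_subst G g w' = \<one>)"
proof -
  let ?b = "inv a"
  \<comment> \<open>\<open>?W\<close> is the commutator of \<open>t a v a\<^sup>-\<^sup>1 t\<^sup>-\<^sup>1\<close> and \<open>t\<^sup>2 a w a\<^sup>-\<^sup>1 t\<^sup>-\<^sup>2\<close>. The two different powers of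
    \<open>t\<close> leave a nonzero power of \<open>t\<close> at each junction.\<close>
  let ?v' = "inv_word v" and ?w' = "inv_word w"
  let ?W = "Inl 1 # Inr a # v @ Inr ?b # Inl 1 # Inr a # w @ Inr ?b # Inl (- 1) # Inr a # ?v' @
    Inr ?b # Inl 1 # Inr a # ?w' @ [Inr ?b, Inl (- 2)]"
  have inv: "t_ended (inv_word u)" if "t_ended u" for u
    using that reduced_inv_word[of u]
    by (auto simp: t_ended_def inv_word_def hd_rev last_rev last_map hd_map)
  have ends: "reduced G u" "u \<noteq> []" "isl (hd u)" "isl (last u)" "u \<in> mixed_words G"
    if "u \<in> {v, w, ?v', ?w'}" for u
  proof -
    have "t_ended u" using that assms(1,2) inv by blast
    then show "reduced G u" "u \<noteq> []" "isl (hd u)" "isl (last u)" "u \<in> mixed_words G"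
      using reduced_mixed_words unfolding t_ended_def by blast+
  qed
  have b: "?b \<in> carrier G" "?b \<noteq> \<one>" using assms(3,4) by auto
  have "t_ended ?W"
    using ends assms(3,4) b by (auto simp: t_ended_def reduced_Cons reduced_append)
  moreover have "list_subst G g ?W = \<one>"
    if g: "g \<in> carrier G" and 1: "list_subst G g v = \<one> \<or> list_subst G g w = \<one>" for g
  proof -
    define x y where "x = list_subst G g v" "y = list_subst G g w"
    have xy: "x \<in> carrier G" "y \<in> carrier G"
      using ends list_subst_closed[OF g] by (auto simp: x_y_def)
    have "list_subst G g ?W = g \<otimes> (a \<otimes> (x \<otimes> (?b \<otimes> (g \<otimes> (a \<otimes> (y \<otimes> (?b \<otimes> (inv g \<otimes> (a \<otimes> (inv x \<otimes>
        (?b \<otimes> (g \<otimes> (a \<otimes> (inv y \<otimes> (?b \<otimes> (inv g \<otimes> inv g))))))))))))))))"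
    proof -
      have mem: "v \<in> mixed_words G" "w \<in> mixed_words G" "?v' \<in> mixed_words G" "?w' \<in> mixed_words G"
        using ends(5) by blast+
      note app = mem[THEN list_subst_append[OF g]]
      have "g [^] (- 2 :: int) = inv g \<otimes> inv g"
        using int_pow_mult[OF g, of "- 1" "- 1"] g by (simp add: int_pow_neg)
      moreover have "list_subst G g ?v' = inv x" "list_subst G g ?w' = inv y"
        using list_subst_inv_word[OF g] ends by (auto simp: x_y_def)
      ultimately show ?thesis
        using mem assms(3) b g by (simp add: app x_y_def int_pow_neg Plus_def image_iff)
    qed
    also have "\<dots> = \<one>"
      using 1 xy g assms(3) b unfolding x_y_def[symmetric] by (auto simp: cancel_inv)
    finally show ?thesis .
  qed
  ultimately show ?thesis by blast
qed

text \<open>The MIF property speaks about one word; for finitely many words their combination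
  into a single one by \<open>t_ended_common\<close> is evaluated at a generic element.\<close>

lemma MIF_exists_generic:
  assumes "MIF G" "finite X" "X \<subseteq> mixed_words G" "\<And>w. w \<in> X \<Longrightarrow> nf G w \<noteq> []"
  shows "\<exists>g\<in>carrier G. \<forall>w\<in>X. list_subst G g w \<noteq> \<one>"
proof -
  have "\<exists>g\<in>carrier G. list_subst G g [Inl 1] \<noteq> \<one>"
    using nontrivial_reduced_evaluation[OF assms(1), of "[Inl 1]"] by (simp add: reduced_Cons)
  then obtain a where a: "a \<in> carrier G" "a \<noteq> \<one>" by fastforce
  have "\<exists>v. t_ended v \<and> (\<forall>g\<in>carrier G. (\<exists>w\<in>X. list_subst G g w = \<one>) \<longrightarrow> list_subst G g v = \<one>)"
    using assms(2,3,4)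
  proof (induction X)
    case empty
    have "t_ended [Inl 1]" by (simp add: t_ended_def reduced_Cons)
    then show ?case by blast
  next
    case (insert w X)
    then obtain v where v: "t_ended v"
      "\<And>g. g \<in> carrier G \<Longrightarrow> \<exists>w\<in>X. list_subst G g w = \<one> \<Longrightarrow> list_subst G g v = \<one>"
      by auto
    have w: "w \<in> mixed_words G" "nf G w \<noteq> []" using insert.prems by auto
    have "reduced G (nf G w)" using w by (simp add: reduced_foldr_lmul_nf)
    then obtain w' where w': "t_ended w'"
      "\<And>g. g \<in> carrier G \<Longrightarrow> list_subst G g (nf G w) = \<one> \<Longrightarrow> list_subst G g w' = \<one>"
      using exists_t_ended w(2) by blast
    have "list_subst G g (nf G w) = list_subst G g w" if "g \<in> carrier G" for g
      using list_subst_cong[OF that equiv_nf[OF w(1)]] by simp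
    then show ?case using t_ended_common[OF v(1) w'(1) a] v(2) w'(2) by (metis insert_iff)
  qed
  then obtain v where "t_ended v" and v:
    "\<And>g. g \<in> carrier G \<Longrightarrow> \<exists>w\<in>X. list_subst G g w = \<one> \<Longrightarrow> list_subst G g v = \<one>" by blast
  then obtain g where "g \<in> carrier G" "list_subst G g v \<noteq> \<one>"
    using nontrivial_reduced_evaluation[OF assms(1), of v] unfolding t_ended_def by blast
  then show ?thesis using v by blast
qed

text \<open>The equation \<open>a t b t\<^sup>-\<^sup>1 = t c t\<^sup>-\<^sup>1 d\<close> is solved in the free product only in the two obvious ways,
  because in all other cases the word \<open>a t b t\<^sup>-\<^sup>1 d\<^sup>-\<^sup>1 t c\<^sup>-\<^sup>1 t\<^sup>-\<^sup>1\<close> has a nonempty normal form. A generic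
  substitution for \<open>t\<close> preserves this for finitely many coefficients.\<close>

lemma MIF_exists_conjugator:
  assumes "MIF G" "finite F" "F \<subseteq> carrier G"
  shows "\<exists>g\<in>carrier G. \<forall>a\<in>F. \<forall>b\<in>F. \<forall>c\<in>F. \<forall>d\<in>F.
    a \<otimes> (g \<otimes> b \<otimes> inv g) = g \<otimes> c \<otimes> inv g \<otimes> d \<longleftrightarrow> b = \<one> \<and> c = \<one> \<and> a = d \<or> a = \<one> \<and> d = \<one> \<and> b = c"
proof -
  let ?w = "\<lambda>(a, b, c, d). [Inr a, Inl 1, Inr b, Inl (- 1), Inr (inv d), Inl 1, Inr (inv c), Inl (- 1)]"
  let ?good = "\<lambda>(a, b, c, d). b = \<one> \<and> c = \<one> \<and> a = d \<or> a = \<one> \<and> d = \<one> \<and> b = c"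
  let ?I = "{p \<in> F \<times> F \<times> F \<times> F. \<not> ?good p}"
  have nontrivial: "nf G (?w p) \<noteq> []" if "p \<in> ?I" for p
  proof -
    obtain a b c d where p: "p = (a, b, c, d)" by (cases p)
    have mem: "a \<in> carrier G" "b \<in> carrier G" "c \<in> carrier G" "d \<in> carrier G"
      using that assms(3) p by auto
    have eq: "x \<otimes> inv y = \<one> \<longleftrightarrow> x = y" if "x \<in> carrier G" "y \<in> carrier G" for x y
      using inv_solve_right[of \<one> x y] that by auto
    have "\<not> ?good (a, b, c, d)" using that p by simp
    then show ?thesis
      using mem p by (cases "a = \<one>"; cases "b = \<one>"; cases "c = \<one>"; cases "d = \<one>") (simp_all add: eq)
  qed
  obtain g where g: "g \<in> carrier G" "\<And>p. p \<in> ?I \<Longrightarrow> list_subst G g (?w p) \<noteq> \<one>"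
  proof -
    define w :: "'a \<times> 'a \<times> 'a \<times> 'a \<Rightarrow> (int + 'a) list" where "w = ?w"
    define I where "I = ?I"
    have "finite I" using assms(2) by (simp add: I_def)
    moreover have "w ` I \<subseteq> mixed_words G" using subsetD[OF assms(3)] by (auto simp: w_def I_def)
    moreover have "\<And>p. p \<in> I \<Longrightarrow> nf G (w p) \<noteq> []" using nontrivial unfolding w_def I_def .
    ultimately have "\<exists>g\<in>carrier G. \<forall>v\<in>w ` I. list_subst G g v \<noteq> \<one>"
      by (intro MIF_exists_generic[OF assms(1)]) auto
    then obtain g where "g \<in> carrier G" "\<And>p. p \<in> I \<Longrightarrow> list_subst G g (w p) \<noteq> \<one>" by blast
    then show ?thesis by (intro that) (simp_all only: w_def I_def)
  qed
  have "a \<otimes> (g \<otimes> b \<otimes> inv g) = g \<otimes> c \<otimes> inv g \<otimes> d \<longleftrightarrow> ?good (a, b, c, d)"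
    if "a \<in> F" "b \<in> F" "c \<in> F" "d \<in> F" for a b c d
  proof
    have mem: "a \<in> carrier G" "b \<in> carrier G" "c \<in> carrier G" "d \<in> carrier G" using that assms(3) by auto
    {
      assume eq: "a \<otimes> (g \<otimes> b \<otimes> inv g) = g \<otimes> c \<otimes> inv g \<otimes> d"
      have "list_subst G g (?w (a, b, c, d)) = a \<otimes> (g \<otimes> b \<otimes> inv g) \<otimes> inv (g \<otimes> c \<otimes> inv g \<otimes> d)"
        using mem g(1) by (simp add: int_pow_neg inv_mult_group m_assoc)
      also have "\<dots> = \<one>" using eq mem g(1) by simp
      finally show "?good (a, b, c, d)" using g(2)[of "(a, b, c, d)"] that by blast
    }
    assume "?good (a, b, c, d)"
    then show "a \<otimes> (g \<otimes> b \<otimes> inv g) = g \<otimes> c \<otimes> inv g \<otimes> d"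
      using mem g(1) by auto
  qed
  then show ?thesis using g(1) by (intro bexI[of _ g]) simp_all
qed

end

section \<open>The Hilbert space \<open>\<ell>\<^sup>2(S)\<close>\<close>

abbreviation support_in :: "'a set \<Rightarrow> ('a \<Rightarrow> complex) \<Rightarrow> bool" where
  "support_in S f \<equiv> \<forall>x. x \<notin> S \<longrightarrow> f x = 0"

lemma ell2_norm_nonneg [simp]: "0 \<le> ell2_norm S f"
  by (simp add: ell2_norm_def infsum_nonneg)

lemma ell2_norm_power2: "(ell2_norm S f)\<^sup>2 = (\<Sum>\<^sub>\<infinity>x\<in>S. (cmod (f x))\<^sup>2)"
  by (simp add: ell2_norm_def infsum_nonneg)

lemma L2_set_le_ell2_norm:
  assumes "f \<in> ell2 S" "finite F" "F \<subseteq> S"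
  shows "L2_set (\<lambda>x. cmod (f x)) F \<le> ell2_norm S f"
  unfolding L2_set_def ell2_norm_def
  using assms by (intro real_sqrt_le_mono finite_sum_le_infsum) (auto simp: ell2_def)

text \<open>Membership and norm bounds are controlled by finite sums, so that the finite-dimensional
  Minkowski and Cauchy--Schwarz inequalities carry over.\<close>

lemma ell2_normI:
  assumes "support_in S f" "0 \<le> C" "\<And>F. finite F \<Longrightarrow> F \<subseteq> S \<Longrightarrow> L2_set (\<lambda>x. cmod (f x)) F \<le> C"
  shows "f \<in> ell2 S" "ell2_norm S f \<le> C"
proof -
  have *: "(\<Sum>x\<in>F. (cmod (f x))\<^sup>2) \<le> C\<^sup>2" if "finite F" "F \<subseteq> S" for F
    using assms(3)[OF that] by (simp add: L2_set_def sqrt_le_D)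
  then have sum: "(\<lambda>x. (cmod (f x))\<^sup>2) summable_on S"
    by (intro nonneg_bdd_above_summable_on bdd_aboveI[of _ "C\<^sup>2"]) auto
  then show "f \<in> ell2 S" using assms(1) by (simp add: ell2_def)
  have "(ell2_norm S f)\<^sup>2 \<le> C\<^sup>2"
    unfolding ell2_norm_power2 by (rule infsum_le_finite_sums[OF sum *])
  then show "ell2_norm S f \<le> C" using assms(2) by (simp add: power2_le_iff_abs_le)
qed

lemma ell2_add:
  assumes "f \<in> ell2 S" "g \<in> ell2 S"
  shows "(\<lambda>x. f x + g x) \<in> ell2 S" "ell2_norm S (\<lambda>x. f x + g x) \<le> ell2_norm S f + ell2_norm S g"
proof -
  have "L2_set (\<lambda>x. cmod (f x + g x)) F \<le> ell2_norm S f + ell2_norm S g" if "finite F" "F \<subseteq> S" for F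
  proof -
    have "L2_set (\<lambda>x. cmod (f x + g x)) F \<le> L2_set (\<lambda>x. cmod (f x) + cmod (g x)) F"
      by (rule L2_set_mono) (simp_all add: norm_triangle_ineq)
    also have "\<dots> \<le> L2_set (\<lambda>x. cmod (f x)) F + L2_set (\<lambda>x. cmod (g x)) F"
      by (rule L2_set_triangle_ineq)
    also have "\<dots> \<le> ell2_norm S f + ell2_norm S g"
      by (intro add_mono L2_set_le_ell2_norm assms that)
    finally show ?thesis .
  qed
  then show "(\<lambda>x. f x + g x) \<in> ell2 S" "ell2_norm S (\<lambda>x. f x + g x) \<le> ell2_norm S f + ell2_norm S g"
    using assms by (intro ell2_normI; auto simp: ell2_def)+
qed

lemma ell2_scale:
  assumes "f \<in> ell2 S"
  shows "(\<lambda>x. c * f x) \<in> ell2 S"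
  using assms by (simp add: ell2_def norm_mult power_mult_distrib summable_on_cmult_right)

lemma ell2_norm_scale: "ell2_norm S (\<lambda>x. c * f x) = cmod c * ell2_norm S f"
  by (simp add: ell2_norm_def norm_mult power_mult_distrib infsum_cmult_right' real_sqrt_mult)

lemma ell2_zero [simp]: "(\<lambda>_. 0) \<in> ell2 S"
  by (simp add: ell2_def)

lemma ell2_diff:
  assumes "f \<in> ell2 S" "g \<in> ell2 S"
  shows "(\<lambda>x. f x - g x) \<in> ell2 S"
  using ell2_add(1)[OF assms(1) ell2_scale[OF assms(2), of "- 1"]] by simp

lemma ell2_norm_diff_commute: "ell2_norm S (\<lambda>x. f x - g x) = ell2_norm S (\<lambda>x. g x - f x)"
  by (simp add: ell2_norm_def norm_minus_commute)

lemma ell2_norm_diff_triangle: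
  assumes "f \<in> ell2 S" "g \<in> ell2 S" "h \<in> ell2 S"
  shows "ell2_norm S (\<lambda>x. f x - h x) \<le> ell2_norm S (\<lambda>x. f x - g x) + ell2_norm S (\<lambda>x. g x - h x)"
  using ell2_add(2)[OF ell2_diff[OF assms(1,2)] ell2_diff[OF assms(2,3)]] by simp

lemma ell2_sum:
  assumes "\<And>i. i \<in> I \<Longrightarrow> h i \<in> ell2 S"
  shows "(\<lambda>x. \<Sum>i\<in>I. h i x) \<in> ell2 S"
    and "ell2_norm S (\<lambda>x. \<Sum>i\<in>I. h i x) \<le> (\<Sum>i\<in>I. ell2_norm S (h i))"
proof -
  have "(\<lambda>x. \<Sum>i\<in>I. h i x) \<in> ell2 S \<and> ell2_norm S (\<lambda>x. \<Sum>i\<in>I. h i x) \<le> (\<Sum>i\<in>I. ell2_norm S (h i))"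
    using assms
  proof (induction I rule: infinite_finite_induct)
    case (insert i I)
    then show ?case using ell2_add[of "h i" S "\<lambda>x. \<Sum>i\<in>I. h i x"] by force
  qed (simp_all add: ell2_norm_def)
  then show "(\<lambda>x. \<Sum>i\<in>I. h i x) \<in> ell2 S"
    "ell2_norm S (\<lambda>x. \<Sum>i\<in>I. h i x) \<le> (\<Sum>i\<in>I. ell2_norm S (h i))" by auto
qed

lemma ell2_inner_abs_summable:
  assumes "f \<in> ell2 S" "g \<in> ell2 S"
  shows "(\<lambda>x. norm (f x * cnj (g x))) summable_on S"
    and "(\<Sum>\<^sub>\<infinity>x\<in>S. norm (f x * cnj (g x))) \<le> ell2_norm S f * ell2_norm S g"
proof -
  have *: "(\<Sum>x\<in>F. norm (f x * cnj (g x))) \<le> ell2_norm S f * ell2_norm S g"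
    if "finite F" "F \<subseteq> S" for F
  proof -
    have "(\<Sum>x\<in>F. norm (f x * cnj (g x))) \<le> L2_set (\<lambda>x. cmod (f x)) F * L2_set (\<lambda>x. cmod (g x)) F"
      using L2_set_mult_ineq[of "\<lambda>x. cmod (f x)" "\<lambda>x. cmod (g x)" F] by (simp add: norm_mult)
    also have "\<dots> \<le> ell2_norm S f * ell2_norm S g"
      by (intro mult_mono L2_set_le_ell2_norm assms that) simp_all
    finally show ?thesis .
  qed
  then show sum: "(\<lambda>x. norm (f x * cnj (g x))) summable_on S"
    by (intro nonneg_bdd_above_summable_on bdd_aboveI[of _ "ell2_norm S f * ell2_norm S g"]) auto
  show "(\<Sum>\<^sub>\<infinity>x\<in>S. norm (f x * cnj (g x))) \<le> ell2_norm S f * ell2_norm S g"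
    by (rule infsum_le_finite_sums[OF sum *])
qed

lemma ell2_inner_summable:
  "f \<in> ell2 S \<Longrightarrow> g \<in> ell2 S \<Longrightarrow> (\<lambda>x. f x * cnj (g x)) summable_on S"
  by (rule abs_summable_summable) (rule ell2_inner_abs_summable)

lemma ell2_Cauchy_Schwarz:
  assumes "f \<in> ell2 S" "g \<in> ell2 S"
  shows "cmod (ell2_inner S f g) \<le> ell2_norm S f * ell2_norm S g"
  unfolding ell2_inner_def
  using norm_infsum_bound[OF ell2_inner_abs_summable(1)[OF assms]] ell2_inner_abs_summable(2)[OF assms]
  by linarith

lemma ell2_inner_add_left:
  "f \<in> ell2 S \<Longrightarrow> g \<in> ell2 S \<Longrightarrow> h \<in> ell2 S \<Longrightarrow>
    ell2_inner S (\<lambda>x. f x + g x) h = ell2_inner S f h + ell2_inner S g h"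
  by (simp add: ell2_inner_def distrib_right infsum_add ell2_inner_summable)

lemma ell2_inner_scale_left: "ell2_inner S (\<lambda>x. c * f x) g = c * ell2_inner S f g"
  by (simp add: ell2_inner_def mult.assoc infsum_cmult_right')

lemma ell2_inner_cnj: "cnj (ell2_inner S f g) = ell2_inner S g f"
  unfolding ell2_inner_def infsum_cnj[symmetric] by (rule infsum_cong) (simp add: mult.commute)

lemma ell2_inner_diff_left:
  "f \<in> ell2 S \<Longrightarrow> g \<in> ell2 S \<Longrightarrow> h \<in> ell2 S \<Longrightarrow>
    ell2_inner S (\<lambda>x. f x - g x) h = ell2_inner S f h - ell2_inner S g h"
  using ell2_inner_add_left[of f S "\<lambda>x. - 1 * g x" h] ell2_scale[of g S "- 1"]
    ell2_inner_scale_left[of S "- 1" g h] by simp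

lemma ell2_inner_diff_right:
  "f \<in> ell2 S \<Longrightarrow> g \<in> ell2 S \<Longrightarrow> h \<in> ell2 S \<Longrightarrow>
    ell2_inner S f (\<lambda>x. g x - h x) = ell2_inner S f g - ell2_inner S f h"
  using ell2_inner_diff_left[of g S h f] by (metis complex_cnj_diff ell2_inner_cnj)

lemma ell2_inner_scale_right: "ell2_inner S f (\<lambda>x. c * g x) = cnj c * ell2_inner S f g"
  using ell2_inner_scale_left[of S c g f] by (metis complex_cnj_mult ell2_inner_cnj)

lemma ell2_inner_zero [simp]: "ell2_inner S (\<lambda>_. 0) g = 0" "ell2_inner S g (\<lambda>_. 0) = 0"
  by (simp_all add: ell2_inner_def)

lemma ell2_inner_sum_left:
  assumes "\<And>i. i \<in> I \<Longrightarrow> h i \<in> ell2 S" "g \<in> ell2 S"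
  shows "ell2_inner S (\<lambda>x. \<Sum>i\<in>I. h i x) g = (\<Sum>i\<in>I. ell2_inner S (h i) g)"
  using assms(1)
proof (induction I rule: infinite_finite_induct)
  case (insert i I)
  then show ?case
    using ell2_inner_add_left[of "h i" S "\<lambda>x. \<Sum>i\<in>I. h i x" g] ell2_sum(1)[of I h S] assms(2) by simp
qed simp_all

lemma ell2_inner_sum_right:
  assumes "\<And>i. i \<in> I \<Longrightarrow> h i \<in> ell2 S" "g \<in> ell2 S"
  shows "ell2_inner S g (\<lambda>x. \<Sum>i\<in>I. h i x) = (\<Sum>i\<in>I. ell2_inner S g (h i))"
  using arg_cong[where f = cnj, OF ell2_inner_sum_left[where I = I, OF assms]]
  by (simp add: ell2_inner_cnj)

lemma ell2_inner_self:
  assumes "f \<in> ell2 S"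
  shows "ell2_inner S f f = complex_of_real ((ell2_norm S f)\<^sup>2)"
proof -
  have "((\<lambda>x. complex_of_real ((cmod (f x))\<^sup>2)) has_sum complex_of_real ((ell2_norm S f)\<^sup>2)) S"
    unfolding ell2_norm_power2 using assms by (intro has_sum_of_real has_sum_infsum) (simp add: ell2_def)
  then show ?thesis
    unfolding ell2_inner_def by (intro infsumI) (simp add: complex_norm_square[symmetric] del: of_real_power)
qed

lemma ell2_norm_power2_diff:
  assumes "f \<in> ell2 S" "g \<in> ell2 S"
  shows "(ell2_norm S (\<lambda>x. f x - g x))\<^sup>2 =
    (ell2_norm S f)\<^sup>2 + (ell2_norm S g)\<^sup>2 - 2 * Re (ell2_inner S f g)"
proof -
  have "complex_of_real ((ell2_norm S (\<lambda>x. f x - g x))\<^sup>2) =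
    complex_of_real ((ell2_norm S f)\<^sup>2) + complex_of_real ((ell2_norm S g)\<^sup>2)
      - (ell2_inner S f g + cnj (ell2_inner S f g))"
    using assms ell2_diff[OF assms] ell2_inner_cnj[of S f g]
    by (simp add: ell2_inner_diff_left ell2_inner_diff_right ell2_inner_self[symmetric] del: of_real_power)
  also have "\<dots> = complex_of_real ((ell2_norm S f)\<^sup>2 + (ell2_norm S g)\<^sup>2 - 2 * Re (ell2_inner S f g))"
    by (simp add: complex_add_cnj)
  finally show ?thesis by (simp only: of_real_eq_iff)
qed

lemma norm_le_ell2_norm:
  assumes "f \<in> ell2 S"
  shows "cmod (f x) \<le> ell2_norm S f"
proof (cases "x \<in> S")
  case True
  then show ?thesis using L2_set_le_ell2_norm[OF assms, of "{x}"] by simp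
qed (use assms in \<open>simp add: ell2_def\<close>)

lemma ell2_norm_eq_0:
  "f \<in> ell2 S \<Longrightarrow> ell2_norm S f = 0 \<Longrightarrow> f = (\<lambda>_. 0)"
  using norm_le_ell2_norm[of f S] by fastforce

definition point_mass :: "'a \<Rightarrow> 'a \<Rightarrow> complex" where
  "point_mass x = (\<lambda>y. if y = x then 1 else 0)"

lemma point_mass_ell2: "x \<in> S \<Longrightarrow> point_mass x \<in> ell2 S"
  by (rule ell2_normI[of _ _ 1])
     (auto simp: point_mass_def L2_set_def if_distrib[of "\<lambda>c. (cmod c)\<^sup>2"] cong: if_cong)

lemma ell2_inner_point_mass:
  assumes "x \<in> S"
  shows "ell2_inner S f (point_mass x) = f x"
proof -
  have "ell2_inner S f (point_mass x) = (\<Sum>\<^sub>\<infinity>y\<in>{x}. f y * cnj (point_mass x y))"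
    unfolding ell2_inner_def using assms by (intro infsum_cong_neutral) (auto simp: point_mass_def)
  then show ?thesis by (simp add: point_mass_def)
qed

lemma ell2_norm_point_mass:
  assumes "x \<in> S"
  shows "ell2_norm S (point_mass x) = 1"
proof -
  have "complex_of_real ((ell2_norm S (point_mass x))\<^sup>2) = 1"
    using ell2_inner_self[OF point_mass_ell2[OF assms]] ell2_inner_point_mass[OF assms, of "point_mass x"]
    by (simp add: point_mass_def)
  then have "(ell2_norm S (point_mass x))\<^sup>2 = 1" by (simp only: of_real_eq_1_iff)
  then show ?thesis by (smt (verit) ell2_norm_nonneg power2_eq_1_iff)
qed

text \<open>Written as a combination of point masses, so that bounded operators can be applied termwise.\<close>

definition restrict_to :: "'a set \<Rightarrow> ('a \<Rightarrow> complex) \<Rightarrow> 'a \<Rightarrow> complex" where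
  "restrict_to F f = (\<lambda>x. \<Sum>k\<in>F. f k * point_mass k x)"

lemma restrict_to_apply: "finite F \<Longrightarrow> restrict_to F f x = (if x \<in> F then f x else 0)"
  by (simp add: restrict_to_def point_mass_def if_distrib sum.delta cong: if_cong)

lemma restrict_to_ell2: "F \<subseteq> S \<Longrightarrow> restrict_to F f \<in> ell2 S"
  unfolding restrict_to_def by (intro ell2_sum ell2_scale point_mass_ell2) auto

lemma ell2_norm_restrict_to:
  assumes "finite F" "F \<subseteq> S"
  shows "(ell2_norm S (restrict_to F f))\<^sup>2 = (\<Sum>k\<in>F. (cmod (f k))\<^sup>2)"
  unfolding ell2_norm_power2
  using assms by (subst infsum_cong_neutral[where T = F and g = "\<lambda>k. (cmod (f k))\<^sup>2"])
    (auto simp: restrict_to_apply)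

text \<open>The restriction is an orthogonal projection, so Pythagoras applies; in particular the error
  depends only on the moduli of the values.\<close>

lemma ell2_norm_diff_restrict_to:
  assumes "f \<in> ell2 S" "finite F" "F \<subseteq> S"
  shows "(ell2_norm S (\<lambda>x. f x - restrict_to F f x))\<^sup>2 = (ell2_norm S f)\<^sup>2 - (\<Sum>k\<in>F. (cmod (f k))\<^sup>2)"
proof -
  have "ell2_inner S f (restrict_to F f) = (\<Sum>k\<in>F. cnj (f k) * f k)"
    unfolding restrict_to_def using assms
    by (subst ell2_inner_sum_right)
      (auto intro!: sum.cong ell2_scale point_mass_ell2 simp: ell2_inner_scale_right ell2_inner_point_mass)
  then have "Re (ell2_inner S f (restrict_to F f)) = (\<Sum>k\<in>F. (cmod (f k))\<^sup>2)"
    by (simp add: cmod_power2) (simp add: power2_eq_square)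
  then show ?thesis
    using ell2_norm_power2_diff[OF assms(1) restrict_to_ell2[OF assms(3)], of f]
      ell2_norm_restrict_to[OF assms(2,3), of f] by simp
qed

lemma ell2_restrict_to_approx:
  assumes "f \<in> ell2 S" "0 < e" "finite E" "E \<subseteq> S"
  shows "\<exists>F. finite F \<and> E \<subseteq> F \<and> F \<subseteq> S \<and> ell2_norm S (\<lambda>x. f x - restrict_to F f x) \<le> e"
proof -
  have sum: "(\<lambda>x. (cmod (f x))\<^sup>2) summable_on S" using assms(1) by (simp add: ell2_def)
  obtain F where F: "finite F" "F \<subseteq> S" "dist (\<Sum>x\<in>F. (cmod (f x))\<^sup>2) ((ell2_norm S f)\<^sup>2) \<le> e\<^sup>2"
    using infsum_finite_approximation[OF sum, of "e\<^sup>2"] assms(2) by (auto simp: ell2_norm_power2)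
  have "(\<Sum>x\<in>F. (cmod (f x))\<^sup>2) \<le> (\<Sum>x\<in>F \<union> E. (cmod (f x))\<^sup>2)"
    using F(1) assms(3) by (intro sum_mono2) auto
  then have "(ell2_norm S (\<lambda>x. f x - restrict_to (F \<union> E) f x))\<^sup>2 \<le> e\<^sup>2"
    using ell2_norm_diff_restrict_to[OF assms(1), of "F \<union> E"] F assms(3,4) by (auto simp: dist_real_def)
  then show ?thesis using assms F by (intro exI[of _ "F \<union> E"]) (auto simp: power2_le_iff_abs_le)
qed

section \<open>Bounded operators and adjoints\<close>

lemma bounded_opsD:
  assumes "T \<in> bounded_ops S"
  shows "f \<in> ell2 S \<Longrightarrow> T f \<in> ell2 S"
    and "f \<in> ell2 S \<Longrightarrow> g \<in> ell2 S \<Longrightarrow> T (\<lambda>x. f x + g x) = (\<lambda>x. T f x + T g x)"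
    and "f \<in> ell2 S \<Longrightarrow> T (\<lambda>x. c * f x) = (\<lambda>x. c * T f x)"
    and "f \<notin> ell2 S \<Longrightarrow> T f = undefined"
  using assms by (auto simp: bounded_ops_def)

lemma bounded_ops_bound:
  assumes "T \<in> bounded_ops S"
  obtains C where "0 \<le> C" "\<And>f. f \<in> ell2 S \<Longrightarrow> ell2_norm S (T f) \<le> C * ell2_norm S f"
proof -
  obtain C where C: "\<forall>f\<in>ell2 S. ell2_norm S (T f) \<le> C * ell2_norm S f"
    using assms by (auto simp: bounded_ops_def)
  have "ell2_norm S (T f) \<le> max C 0 * ell2_norm S f" if "f \<in> ell2 S" for f
  proof -
    have "C * ell2_norm S f \<le> max C 0 * ell2_norm S f" by (intro mult_right_mono) auto
    then show ?thesis using C that by fastforce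
  qed
  then show ?thesis using that[of "max C 0"] by simp
qed

lemma bounded_opsI:
  assumes "\<And>f. f \<in> ell2 S \<Longrightarrow> T f \<in> ell2 S" "\<And>f. f \<notin> ell2 S \<Longrightarrow> T f = undefined"
    "\<And>f g. f \<in> ell2 S \<Longrightarrow> g \<in> ell2 S \<Longrightarrow> T (\<lambda>x. f x + g x) = (\<lambda>x. T f x + T g x)"
    "\<And>c f. f \<in> ell2 S \<Longrightarrow> T (\<lambda>x. c * f x) = (\<lambda>x. c * T f x)"
    "\<And>f. f \<in> ell2 S \<Longrightarrow> ell2_norm S (T f) \<le> C * ell2_norm S f"
  shows "T \<in> bounded_ops S"
  using assms by (auto simp: bounded_ops_def intro!: exI[of _ C])

lemma bounded_ops_diff:
  assumes "T \<in> bounded_ops S" "f \<in> ell2 S" "g \<in> ell2 S"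
  shows "T (\<lambda>x. f x - g x) = (\<lambda>x. T f x - T g x)"
  using bounded_opsD(2)[OF assms(1,2) ell2_scale[OF assms(3), of "- 1"]]
    bounded_opsD(3)[OF assms(1,3), of "- 1"] by simp

lemma bounded_ops_zero: "T \<in> bounded_ops S \<Longrightarrow> T (\<lambda>_. 0) = (\<lambda>_. 0)"
  using bounded_opsD(3)[of T S "\<lambda>_. 0" 0] by simp

lemma bounded_ops_sum:
  assumes "T \<in> bounded_ops S" "\<And>i. i \<in> I \<Longrightarrow> h i \<in> ell2 S"
  shows "T (\<lambda>x. \<Sum>i\<in>I. c i * h i x) = (\<lambda>x. \<Sum>i\<in>I. c i * T (h i) x)"
  using assms(2)
proof (induction I rule: infinite_finite_induct)
  case (insert i I)
  have "(\<lambda>x. \<Sum>i\<in>I. c i * h i x) \<in> ell2 S" using insert.prems by (intro ell2_sum ell2_scale) auto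
  then show ?case
    using insert bounded_opsD(2)[OF assms(1) ell2_scale[of "h i" S "c i"]] bounded_opsD(3)[OF assms(1)]
    by simp
qed (simp_all add: bounded_ops_zero[OF assms(1)])

text \<open>Finitely supported functions are dense, so a bounded functional is determined by its values on
  point masses. The conditions are spelled out because \<open>\<phi>\<close> is a function on all of the ambient type.\<close>

lemma bounded_functional_eq_0:
  fixes \<phi> :: "('a \<Rightarrow> complex) \<Rightarrow> complex"
  assumes add: "\<And>f g. f \<in> ell2 S \<Longrightarrow> g \<in> ell2 S \<Longrightarrow> \<phi> (\<lambda>x. f x + g x) = \<phi> f + \<phi> g"
    and scale: "\<And>c f. f \<in> ell2 S \<Longrightarrow> \<phi> (\<lambda>x. c * f x) = c * \<phi> f"
    and bound: "\<And>f. f \<in> ell2 S \<Longrightarrow> cmod (\<phi> f) \<le> C * ell2_norm S f"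
    and pm: "\<And>x. x \<in> S \<Longrightarrow> \<phi> (point_mass x) = 0"
    and f: "f \<in> ell2 S"
  shows "\<phi> f = 0"
proof -
  have zero: "\<phi> (\<lambda>_. 0) = 0" using scale[of "\<lambda>_. 0" 0] by simp
  have fin: "\<phi> (restrict_to F f) = 0" if "finite F" "F \<subseteq> S" for F
    using that
  proof (induction F)
    case empty
    then show ?case by (simp add: restrict_to_def zero)
  next
    case (insert k F)
    then have "restrict_to (insert k F) f = (\<lambda>x. f k * point_mass k x + restrict_to F f x)"
      by (simp add: restrict_to_def)
    then show ?case
      using insert add[OF ell2_scale[OF point_mass_ell2] restrict_to_ell2] scale[OF point_mass_ell2] pm
      by simp
  qed
  have "cmod (\<phi> f) \<le> 0 + e" if "0 < e" for e
  proof -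
    obtain F where F: "finite F" "F \<subseteq> S"
      "ell2_norm S (\<lambda>x. f x - restrict_to F f x) \<le> e / (\<bar>C\<bar> + 1)"
      using ell2_restrict_to_approx[OF f, of "e / (\<bar>C\<bar> + 1)" "{}"] \<open>0 < e\<close> by auto
    let ?d = "\<lambda>x. f x - restrict_to F f x"
    have d: "?d \<in> ell2 S" by (intro ell2_diff restrict_to_ell2 f F)
    have "\<phi> f = \<phi> ?d" using add[OF d restrict_to_ell2[OF F(2), of f]] fin[OF F(1,2)] by simp
    then have "cmod (\<phi> f) \<le> C * ell2_norm S ?d" using bound[OF d] by simp
    also have "\<dots> \<le> (\<bar>C\<bar> + 1) * (e / (\<bar>C\<bar> + 1))"
      using F(3) by (intro mult_mono) auto
    finally show ?thesis by simp
  qed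
  then have "cmod (\<phi> f) \<le> 0" by (rule field_le_epsilon)
  then show ?thesis by simp
qed

lemma bounded_ops_ext:
  assumes T: "T \<in> bounded_ops S" and R: "R \<in> bounded_ops S"
    and pm: "\<And>x. x \<in> S \<Longrightarrow> T (point_mass x) = R (point_mass x)"
  shows "T = R"
proof (intro ext)
  fix f y
  obtain C D where C: "\<And>f. f \<in> ell2 S \<Longrightarrow> ell2_norm S (T f) \<le> C * ell2_norm S f"
    and D: "\<And>f. f \<in> ell2 S \<Longrightarrow> ell2_norm S (R f) \<le> D * ell2_norm S f"
    using bounded_ops_bound[OF T] bounded_ops_bound[OF R] by metis
  show "T f y = R f y"
  proof (cases "f \<in> ell2 S")
    case True
    have "T f y - R f y = 0"
    proof (rule bounded_functional_eq_0[where C = "C + D", OF _ _ _ _ True])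
      fix f assume f: "f \<in> ell2 S"
      have "cmod (T f y - R f y) \<le> cmod (T f y) + cmod (R f y)" by (rule norm_triangle_ineq4)
      also have "\<dots> \<le> C * ell2_norm S f + D * ell2_norm S f"
        using norm_le_ell2_norm[OF bounded_opsD(1)[OF T f], of y] C[OF f]
          norm_le_ell2_norm[OF bounded_opsD(1)[OF R f], of y] D[OF f] by linarith
      finally show "cmod (T f y - R f y) \<le> (C + D) * ell2_norm S f" by (simp add: distrib_right)
    qed (auto simp: bounded_opsD(2,3)[OF T] bounded_opsD(2,3)[OF R] pm right_diff_distrib)
    then show ?thesis by simp
  next
    case False
    then show ?thesis by (simp add: bounded_opsD(4)[OF T] bounded_opsD(4)[OF R])
  qed
qed

definition is_adjoint ::
  "'a set \<Rightarrow> (('a \<Rightarrow> complex) \<Rightarrow> ('a \<Rightarrow> complex)) \<Rightarrow> (('a \<Rightarrow> complex) \<Rightarrow> ('a \<Rightarrow> complex)) \<Rightarrow> bool" where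
  "is_adjoint S T R \<longleftrightarrow> R \<in> bounded_ops S \<and>
     (\<forall>f\<in>ell2 S. \<forall>g\<in>ell2 S. ell2_inner S (T f) g = ell2_inner S f (R g))"

text \<open>The value of \<open>T\<^sup>* g\<close> at \<open>x\<close> has to be the inner product of \<open>g\<close> with \<open>T \<delta>\<^sub>x\<close>. That this defines a
  square-summable function follows by pairing \<open>g\<close> with \<open>T h\<close>, where \<open>h\<close> is the candidate itself cut off to a
  finite set: this yields \<open>\<parallel>h\<parallel>\<^sup>2 \<le> \<parallel>g\<parallel> C \<parallel>h\<parallel>\<close>.\<close>

lemma exists_adjoint:
  assumes T: "T \<in> bounded_ops S"
  shows "\<exists>R. is_adjoint S T R"
proof -
  obtain C where C: "0 \<le> C" "\<And>f. f \<in> ell2 S \<Longrightarrow> ell2_norm S (T f) \<le> C * ell2_norm S f"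
    using bounded_ops_bound[OF T] by blast
  define r where "r = (\<lambda>g x. if x \<in> S then ell2_inner S g (T (point_mass x)) else 0)"
  note Tpm = bounded_opsD(1)[OF T point_mass_ell2]
  have r: "r g \<in> ell2 S" "ell2_norm S (r g) \<le> C * ell2_norm S g" if g: "g \<in> ell2 S" for g
  proof -
    have "L2_set (\<lambda>x. cmod (r g x)) F \<le> C * ell2_norm S g" if F: "finite F" "F \<subseteq> S" for F
    proof -
      define h where "h = restrict_to F (r g)"
      have h: "h \<in> ell2 S" unfolding h_def by (rule restrict_to_ell2[OF F(2)])
      have "ell2_norm S h = L2_set (\<lambda>x. cmod (r g x)) F"
        using ell2_norm_restrict_to[OF F, of "r g"]
        by (simp add: h_def L2_set_def real_sqrt_unique)
      moreover have "complex_of_real ((ell2_norm S h)\<^sup>2) = ell2_inner S g (T h)"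
      proof -
        have "T h = (\<lambda>x. \<Sum>k\<in>F. r g k * T (point_mass k) x)"
          unfolding h_def restrict_to_def using F by (intro bounded_ops_sum[OF T] point_mass_ell2) auto
        moreover have "ell2_inner S g (\<lambda>x. \<Sum>k\<in>F. r g k * T (point_mass k) x) =
          (\<Sum>k\<in>F. ell2_inner S g (\<lambda>x. r g k * T (point_mass k) x))"
          using F g by (intro ell2_inner_sum_right ell2_scale Tpm) auto
        moreover have "(\<Sum>k\<in>F. ell2_inner S g (\<lambda>x. r g k * T (point_mass k) x)) =
          (\<Sum>k\<in>F. complex_of_real ((cmod (r g k))\<^sup>2))"
        proof (rule sum.cong[OF HOL.refl])
          fix k assume "k \<in> F"
          then have "ell2_inner S g (T (point_mass k)) = r g k" using F(2) by (auto simp: r_def)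
          then show "ell2_inner S g (\<lambda>x. r g k * T (point_mass k) x) = complex_of_real ((cmod (r g k))\<^sup>2)"
            unfolding ell2_inner_scale_right complex_norm_square by (simp add: mult.commute)
        qed
        ultimately show ?thesis
          using ell2_norm_restrict_to[OF F, of "r g"] by (simp add: h_def)
      qed
      then have "cmod (complex_of_real ((ell2_norm S h)\<^sup>2)) \<le> ell2_norm S g * ell2_norm S (T h)"
        using ell2_Cauchy_Schwarz[OF g bounded_opsD(1)[OF T h]] by simp
      then have "(ell2_norm S h)\<^sup>2 \<le> ell2_norm S g * (C * ell2_norm S h)"
        using mult_left_mono[OF C(2)[OF h] ell2_norm_nonneg[of S g]] by (simp add: norm_power)
      then have "ell2_norm S h * ell2_norm S h \<le> ell2_norm S h * (C * ell2_norm S g)"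
        by (simp add: power2_eq_square mult_ac)
      then have "ell2_norm S h \<le> C * ell2_norm S g"
        using C(1) by (cases "ell2_norm S h = 0") (auto simp: mult_le_cancel_left order_less_le)
      ultimately show ?thesis by simp
    qed
    then show "r g \<in> ell2 S" "ell2_norm S (r g) \<le> C * ell2_norm S g"
      using C(1) by (intro ell2_normI; auto simp: r_def)+
  qed
  have "restrict r (ell2 S) \<in> bounded_ops S"
  proof (rule bounded_opsI)
    fix f g assume "f \<in> ell2 S" "g \<in> ell2 S"
    then show "restrict r (ell2 S) (\<lambda>x. f x + g x) = (\<lambda>x. restrict r (ell2 S) f x + restrict r (ell2 S) g x)"
      using ell2_add(1)[of f S g] Tpm by (auto simp: r_def ell2_inner_add_left)
  next
    fix c f assume "f \<in> ell2 S"
    then show "restrict r (ell2 S) (\<lambda>x. c * f x) = (\<lambda>x. c * restrict r (ell2 S) f x)"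
      using ell2_scale[of f S c] by (auto simp: r_def ell2_inner_scale_left)
  qed (use r in auto)
  moreover have "ell2_inner S (T f) g = ell2_inner S f (r g)" if f: "f \<in> ell2 S" and g: "g \<in> ell2 S" for f g
  proof -
    have "ell2_inner S (T f) g - ell2_inner S f (r g) = 0"
    proof (rule bounded_functional_eq_0[where C = "C * ell2_norm S g + ell2_norm S (r g)", OF _ _ _ _ f])
      fix f assume f: "f \<in> ell2 S"
      have "cmod (ell2_inner S (T f) g - ell2_inner S f (r g)) \<le>
        cmod (ell2_inner S (T f) g) + cmod (ell2_inner S f (r g))" by (rule norm_triangle_ineq4)
      also have "\<dots> \<le> (C * ell2_norm S f) * ell2_norm S g + ell2_norm S f * ell2_norm S (r g)"
        using ell2_Cauchy_Schwarz[OF bounded_opsD(1)[OF T f] g] ell2_Cauchy_Schwarz[OF f r(1)[OF g]]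
          mult_right_mono[OF C(2)[OF f] ell2_norm_nonneg[of S g]] by linarith
      finally show "cmod (ell2_inner S (T f) g - ell2_inner S f (r g)) \<le>
        (C * ell2_norm S g + ell2_norm S (r g)) * ell2_norm S f" by (simp add: algebra_simps)
    next
      fix x assume x: "x \<in> S"
      have "ell2_inner S (point_mass x) (r g) = cnj (r g x)"
        using ell2_inner_cnj[of S "r g" "point_mass x"] ell2_inner_point_mass[OF x, of "r g"] by simp
      then show "ell2_inner S (T (point_mass x)) g - ell2_inner S (point_mass x) (r g) = 0"
        using x by (simp add: r_def ell2_inner_cnj)
    qed (use g r in \<open>auto simp: bounded_opsD[OF T] ell2_inner_add_left ell2_inner_scale_left right_diff_distrib\<close>)
    then show ?thesis by simp
  qed
  ultimately show ?thesis by (auto simp: is_adjoint_def)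
qed

lemma is_adjoint_unique:
  assumes "is_adjoint S T R" "is_adjoint S T R'"
  shows "R = R'"
proof (intro ext)
  fix g x
  have RR: "R \<in> bounded_ops S" "R' \<in> bounded_ops S" using assms by (auto simp: is_adjoint_def)
  show "R g x = R' g x"
  proof (cases "g \<in> ell2 S")
    case g: True
    note mem = bounded_opsD(1)[OF RR(1) g] bounded_opsD(1)[OF RR(2) g]
    show ?thesis
    proof (cases "x \<in> S")
      case True
      have "ell2_inner S (point_mass x) (R g) = ell2_inner S (point_mass x) (R' g)"
        using assms point_mass_ell2[OF True] g unfolding is_adjoint_def by metis
      then show ?thesis
        using True by (metis complex_cnj_cnj ell2_inner_cnj ell2_inner_point_mass)
    next
      case False
      then show ?thesis using mem by (simp add: ell2_def)
    qed
  next
    case False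
    then show ?thesis by (simp add: bounded_opsD(4)[OF RR(1)] bounded_opsD(4)[OF RR(2)])
  qed
qed

lemma adjoint_op_eqI: "is_adjoint S T R \<Longrightarrow> adjoint_op S T = R"
  unfolding adjoint_op_def is_adjoint_def[symmetric] by (rule the_equality) (auto intro: is_adjoint_unique)

lemma is_adjoint_adjoint_op: "T \<in> bounded_ops S \<Longrightarrow> is_adjoint S T (adjoint_op S T)"
  using exists_adjoint adjoint_op_eqI by metis

lemma adjoint_op_bounded: "T \<in> bounded_ops S \<Longrightarrow> adjoint_op S T \<in> bounded_ops S"
  using is_adjoint_adjoint_op by (auto simp: is_adjoint_def)

lemma ell2_inner_adjoint_op:
  assumes "T \<in> bounded_ops S" "f \<in> ell2 S" "g \<in> ell2 S"
  shows "ell2_inner S (T f) g = ell2_inner S f (adjoint_op S T g)"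
    and "ell2_inner S (adjoint_op S T f) g = ell2_inner S f (T g)"
proof -
  have *: "ell2_inner S (T f) g = ell2_inner S f (adjoint_op S T g)" if "f \<in> ell2 S" "g \<in> ell2 S" for f g
    using is_adjoint_adjoint_op[OF assms(1)] that by (auto simp: is_adjoint_def)
  show "ell2_inner S (T f) g = ell2_inner S f (adjoint_op S T g)" using * assms by blast
  show "ell2_inner S (adjoint_op S T f) g = ell2_inner S f (T g)"
    using *[OF assms(3,2)] ell2_inner_cnj by metis
qed

lemma adjoint_op_adjoint_op: "T \<in> bounded_ops S \<Longrightarrow> adjoint_op S (adjoint_op S T) = T"
  by (rule adjoint_op_eqI) (auto simp: is_adjoint_def ell2_inner_adjoint_op(2))

lemma compose_bounded_ops:
  assumes T: "T \<in> bounded_ops S" and R: "R \<in> bounded_ops S"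
  shows "compose (ell2 S) T R \<in> bounded_ops S"
proof -
  obtain C D where C: "0 \<le> C" "\<And>f. f \<in> ell2 S \<Longrightarrow> ell2_norm S (T f) \<le> C * ell2_norm S f"
    and D: "\<And>f. f \<in> ell2 S \<Longrightarrow> ell2_norm S (R f) \<le> D * ell2_norm S f"
    using bounded_ops_bound[OF T] bounded_ops_bound[OF R] by metis
  show ?thesis
  proof (rule bounded_opsI)
    fix f assume f: "f \<in> ell2 S"
    have "ell2_norm S (T (R f)) \<le> C * (D * ell2_norm S f)"
      using C(2)[OF bounded_opsD(1)[OF R f]] mult_left_mono[OF D[OF f] C(1)] by linarith
    then show "ell2_norm S (compose (ell2 S) T R f) \<le> (C * D) * ell2_norm S f"
      using f by (simp add: compose_def)
  qed (auto simp: compose_def bounded_opsD[OF T] bounded_opsD[OF R] ell2_add ell2_scale)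
qed

lemma adjoint_op_compose:
  assumes "T \<in> bounded_ops S" "R \<in> bounded_ops S"
  shows "adjoint_op S (compose (ell2 S) T R) = compose (ell2 S) (adjoint_op S R) (adjoint_op S T)"
proof (rule adjoint_op_eqI)
  show "is_adjoint S (compose (ell2 S) T R) (compose (ell2 S) (adjoint_op S R) (adjoint_op S T))"
    using assms adjoint_op_bounded[of T S] adjoint_op_bounded[of R S]
    by (auto simp: is_adjoint_def compose_bounded_ops compose_eq ell2_inner_adjoint_op(1) bounded_opsD(1))
qed

lemma scalar_op_bounded: "scalar_op S c \<in> bounded_ops S"
  by (rule bounded_opsI[where C = "cmod c"])
    (auto simp: scalar_op_def ell2_scale ell2_add ell2_norm_scale algebra_simps)

lemma adjoint_op_scalar_op: "adjoint_op S (scalar_op S c) = scalar_op S (cnj c)"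
  by (rule adjoint_op_eqI)
    (simp add: is_adjoint_def scalar_op_bounded, simp add: scalar_op_def ell2_inner_scale_left ell2_inner_scale_right)

lemma minus_op_bounded:
  assumes T: "T \<in> bounded_ops S" and R: "R \<in> bounded_ops S"
  shows "minus_op S T R \<in> bounded_ops S"
proof -
  obtain C D where C: "\<And>f. f \<in> ell2 S \<Longrightarrow> ell2_norm S (T f) \<le> C * ell2_norm S f"
    and D: "\<And>f. f \<in> ell2 S \<Longrightarrow> ell2_norm S (R f) \<le> D * ell2_norm S f"
    using bounded_ops_bound[OF T] bounded_ops_bound[OF R] by metis
  show ?thesis
  proof (rule bounded_opsI)
    fix f assume f: "f \<in> ell2 S"
    note mem = bounded_opsD(1)[OF T f] bounded_opsD(1)[OF R f]
    have "ell2_norm S (\<lambda>x. T f x - R f x) \<le> ell2_norm S (T f) + ell2_norm S (R f)"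
      using ell2_norm_diff_triangle[OF mem(1) ell2_zero mem(2)] ell2_norm_diff_commute[of S "\<lambda>_. 0" "R f"]
      by simp
    then show "ell2_norm S (minus_op S T R f) \<le> (C + D) * ell2_norm S f"
      using f C[OF f] D[OF f] by (simp add: minus_op_def distrib_right)
  qed (auto simp: minus_op_def bounded_opsD[OF T] bounded_opsD[OF R] ell2_add ell2_scale ell2_diff
      algebra_simps)
qed

lemma compose_assoc_ops:
  "R \<in> bounded_ops S \<Longrightarrow> Q \<in> bounded_ops S \<Longrightarrow>
    compose (ell2 S) T (compose (ell2 S) R Q) = compose (ell2 S) (compose (ell2 S) T R) Q"
  by (auto simp: compose_def bounded_opsD(1) fun_eq_iff)

lemma compose_scalar_op:
  assumes "T \<in> bounded_ops S"
  shows "compose (ell2 S) (scalar_op S c) T = (\<lambda>f\<in>ell2 S. \<lambda>x. c * T f x)"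
    and "compose (ell2 S) T (scalar_op S c) = (\<lambda>f\<in>ell2 S. \<lambda>x. c * T f x)"
  using assms by (auto simp: compose_def scalar_op_def fun_eq_iff bounded_opsD ell2_scale)

lemma compose_scalar_op_1:
  assumes "T \<in> bounded_ops S"
  shows "compose (ell2 S) (scalar_op S 1) T = T" "compose (ell2 S) T (scalar_op S 1) = T"
  using assms by (auto simp: compose_scalar_op fun_eq_iff bounded_opsD)

lemma commutant_compose:
  assumes M: "M \<subseteq> bounded_ops S" and T: "T \<in> commutant S M" and R: "R \<in> commutant S M"
  shows "compose (ell2 S) T R \<in> commutant S M"
proof -
  have TR: "T \<in> bounded_ops S" "R \<in> bounded_ops S" using T R by (auto simp: commutant_def)
  have "compose (ell2 S) (compose (ell2 S) T R) Q = compose (ell2 S) Q (compose (ell2 S) T R)"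
    if Q: "Q \<in> M" for Q
  proof -
    have Q': "Q \<in> bounded_ops S" using M Q by blast
    have "compose (ell2 S) (compose (ell2 S) T R) Q = compose (ell2 S) T (compose (ell2 S) Q R)"
      using R Q by (simp add: commutant_def compose_assoc_ops[OF TR(2) Q', symmetric])
    also have "\<dots> = compose (ell2 S) (compose (ell2 S) Q T) R"
      using T Q by (simp add: commutant_def compose_assoc_ops[OF Q' TR(2)])
    finally show ?thesis by (simp add: compose_assoc_ops[OF TR])
  qed
  then show ?thesis by (auto simp: commutant_def compose_bounded_ops TR)
qed

lemma commutant_adjoint_op:
  assumes M: "M \<subseteq> bounded_ops S" "\<And>Q. Q \<in> M \<Longrightarrow> adjoint_op S Q \<in> M" and T: "T \<in> commutant S M"
  shows "adjoint_op S T \<in> commutant S M"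
proof -
  have T': "T \<in> bounded_ops S" using T by (auto simp: commutant_def)
  have "compose (ell2 S) (adjoint_op S T) Q = compose (ell2 S) Q (adjoint_op S T)" if Q: "Q \<in> M" for Q
  proof -
    have Q': "Q \<in> bounded_ops S" "adjoint_op S Q \<in> bounded_ops S" using M Q by blast+
    have "compose (ell2 S) T (adjoint_op S Q) = compose (ell2 S) (adjoint_op S Q) T"
      using T M(2)[OF Q] by (simp add: commutant_def)
    from arg_cong[OF this, of "adjoint_op S"] show ?thesis
      by (simp add: adjoint_op_compose T' Q' adjoint_op_adjoint_op)
  qed
  then show ?thesis by (simp add: commutant_def adjoint_op_bounded T')
qed

lemma scalar_op_commutant: "M \<subseteq> bounded_ops S \<Longrightarrow> scalar_op S c \<in> commutant S M"
  by (auto simp: commutant_def scalar_op_bounded compose_scalar_op)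

section \<open>Translations\<close>

text \<open>Left and right translations are both composition with a bijection of the index set, and their
  boundedness, adjoints and products are treated together in this form.\<close>

definition relabel_op :: "'a set \<Rightarrow> ('a \<Rightarrow> 'a) \<Rightarrow> ('a \<Rightarrow> complex) \<Rightarrow> 'a \<Rightarrow> complex" where
  "relabel_op S \<sigma> = (\<lambda>f\<in>ell2 S. \<lambda>x. if x \<in> S then f (\<sigma> x) else 0)"

lemma relabel_op_ell2:
  assumes "bij_betw \<sigma> S S" "f \<in> ell2 S"
  shows "relabel_op S \<sigma> f \<in> ell2 S" "ell2_norm S (relabel_op S \<sigma> f) = ell2_norm S f"
proof -
  have eq: "(cmod (relabel_op S \<sigma> f x))\<^sup>2 = (cmod (f (\<sigma> x)))\<^sup>2" if "x \<in> S" for x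
    using that assms(2) by (simp add: relabel_op_def)
  have "(\<lambda>x. (cmod (f (\<sigma> x)))\<^sup>2) summable_on S"
    using summable_on_reindex_bij_betw[OF assms(1), of "\<lambda>x. (cmod (f x))\<^sup>2"] assms(2) by (simp add: ell2_def)
  then have "(\<lambda>x. (cmod (relabel_op S \<sigma> f x))\<^sup>2) summable_on S"
    by (simp add: eq cong: summable_on_cong)
  then show "relabel_op S \<sigma> f \<in> ell2 S" using assms(2) by (simp add: ell2_def relabel_op_def)
  show "ell2_norm S (relabel_op S \<sigma> f) = ell2_norm S f"
    using infsum_reindex_bij_betw[OF assms(1), of "\<lambda>x. (cmod (f x))\<^sup>2"]
    by (simp add: ell2_norm_def eq cong: infsum_cong)
qed

lemma relabel_op_bounded: "bij_betw \<sigma> S S \<Longrightarrow> relabel_op S \<sigma> \<in> bounded_ops S"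
  by (rule bounded_opsI[where C = 1])
    (simp_all add: relabel_op_ell2, auto simp: relabel_op_def ell2_add ell2_scale)

lemma ell2_inner_relabel_op:
  assumes "bij_betw \<sigma> S S" "f \<in> ell2 S" "g \<in> ell2 S"
  shows "ell2_inner S (relabel_op S \<sigma> f) (relabel_op S \<sigma> g) = ell2_inner S f g"
  using infsum_reindex_bij_betw[OF assms(1), of "\<lambda>x. f x * cnj (g x)"] assms(2,3)
  by (simp add: ell2_inner_def relabel_op_def cong: infsum_cong)

lemma compose_relabel_op:
  assumes "\<sigma> \<in> S \<rightarrow> S" "bij_betw \<rho> S S"
  shows "compose (ell2 S) (relabel_op S \<sigma>) (relabel_op S \<rho>) = relabel_op S (\<rho> \<circ> \<sigma>)"
proof
  fix f
  show "compose (ell2 S) (relabel_op S \<sigma>) (relabel_op S \<rho>) f = relabel_op S (\<rho> \<circ> \<sigma>) f"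
    using assms relabel_op_ell2(1)[OF assms(2), of f]
    by (cases "f \<in> ell2 S") (auto simp: compose_def relabel_op_def fun_eq_iff)
qed

lemma relabel_op_cong: "(\<And>x. x \<in> S \<Longrightarrow> \<sigma> x = \<rho> x) \<Longrightarrow> relabel_op S \<sigma> = relabel_op S \<rho>"
  by (auto simp: relabel_op_def fun_eq_iff)

lemma relabel_op_id: "(\<And>x. x \<in> S \<Longrightarrow> \<sigma> x = x) \<Longrightarrow> relabel_op S \<sigma> = scalar_op S 1"
  by (auto simp: relabel_op_def scalar_op_def fun_eq_iff ell2_def)

lemma adjoint_relabel_op:
  assumes "bij_betw \<sigma> S S" "bij_betw \<rho> S S" "\<And>x. x \<in> S \<Longrightarrow> \<rho> (\<sigma> x) = x"
  shows "adjoint_op S (relabel_op S \<sigma>) = relabel_op S \<rho>"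
proof (rule adjoint_op_eqI)
  have "relabel_op S \<sigma> (relabel_op S \<rho> g) = g" if g: "g \<in> ell2 S" for g
  proof -
    have "compose (ell2 S) (relabel_op S \<sigma>) (relabel_op S \<rho>) = scalar_op S 1"
      using assms by (subst compose_relabel_op) (auto simp: relabel_op_id bij_betw_def)
    from fun_cong[OF this, of g] show ?thesis using g by (simp add: compose_eq scalar_op_def)
  qed
  then show "is_adjoint S (relabel_op S \<sigma>) (relabel_op S \<rho>)"
    using ell2_inner_relabel_op[OF assms(1)] relabel_op_ell2[OF assms(2)]
    by (auto simp: is_adjoint_def relabel_op_bounded assms(2)) metis
qed

lemma relabel_op_point_mass:
  assumes "x \<in> S" "\<And>y. y \<in> S \<Longrightarrow> \<sigma> y = x \<longleftrightarrow> y = z" "z \<in> S"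
  shows "relabel_op S \<sigma> (point_mass x) = point_mass z"
  using assms point_mass_ell2[OF assms(1)] by (auto simp: relabel_op_def fun_eq_iff point_mass_def)

lemma delta_one_eq: "delta_one G = point_mass \<one>\<^bsub>G\<^esub>"
  by (simp add: delta_one_def point_mass_def)

definition right_reg ::
  "('a, 'm) monoid_scheme \<Rightarrow> 'a \<Rightarrow> ('a \<Rightarrow> complex) \<Rightarrow> ('a \<Rightarrow> complex)" where
  "right_reg G k = relabel_op (carrier G) (\<lambda>x. x \<otimes>\<^bsub>G\<^esub> inv\<^bsub>G\<^esub> k)"

abbreviation op_mult ::
  "('a, 'm) monoid_scheme \<Rightarrow> (('a \<Rightarrow> complex) \<Rightarrow> 'a \<Rightarrow> complex) \<Rightarrow> (('a \<Rightarrow> complex) \<Rightarrow> 'a \<Rightarrow> complex)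
    \<Rightarrow> ('a \<Rightarrow> complex) \<Rightarrow> 'a \<Rightarrow> complex" where
  "op_mult G \<equiv> compose (ell2 (carrier G))"

context group
begin

lemma bij_betw_left_mult: "g \<in> carrier G \<Longrightarrow> bij_betw (\<lambda>x. g \<otimes> x) (carrier G) (carrier G)"
  by (rule bij_betw_byWitness[where f' = "\<lambda>x. inv g \<otimes> x"]) (auto simp: cancel_inv)

lemma bij_betw_right_mult: "g \<in> carrier G \<Longrightarrow> bij_betw (\<lambda>x. x \<otimes> g) (carrier G) (carrier G)"
  by (rule bij_betw_byWitness[where f' = "\<lambda>x. x \<otimes> inv g"]) (auto simp: m_assoc)

lemma left_reg_eq: "left_reg G g = relabel_op (carrier G) (\<lambda>x. inv g \<otimes> x)"
  by (simp add: left_reg_def relabel_op_def)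

lemma left_reg_bounded: "g \<in> carrier G \<Longrightarrow> left_reg G g \<in> bounded_ops (carrier G)"
  unfolding left_reg_eq by (intro relabel_op_bounded bij_betw_left_mult) simp

lemma right_reg_bounded: "k \<in> carrier G \<Longrightarrow> right_reg G k \<in> bounded_ops (carrier G)"
  unfolding right_reg_def by (intro relabel_op_bounded bij_betw_right_mult) simp

lemma left_reg_mult:
  assumes "g \<in> carrier G" "h \<in> carrier G"
  shows "op_mult G (left_reg G g) (left_reg G h) = left_reg G (g \<otimes> h)"
  unfolding left_reg_eq using assms
  by (subst compose_relabel_op)
     (auto intro!: relabel_op_cong bij_betw_left_mult simp: inv_mult_group m_assoc)

lemma left_reg_one: "left_reg G \<one> = scalar_op (carrier G) 1"
  unfolding left_reg_eq by (rule relabel_op_id) simp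

lemma adjoint_left_reg:
  "g \<in> carrier G \<Longrightarrow> adjoint_op (carrier G) (left_reg G g) = left_reg G (inv g)"
  unfolding left_reg_eq by (intro adjoint_relabel_op bij_betw_left_mult) (auto simp: cancel_inv)

lemma left_reg_right_reg_commute:
  assumes "g \<in> carrier G" "k \<in> carrier G"
  shows "op_mult G (left_reg G g) (right_reg G k) = op_mult G (right_reg G k) (left_reg G g)"
  unfolding left_reg_eq right_reg_def using assms
  by (subst (1 2) compose_relabel_op)
     (auto intro!: relabel_op_cong bij_betw_left_mult bij_betw_right_mult simp: m_assoc)

lemma left_reg_point_mass:
  assumes "g \<in> carrier G" "x \<in> carrier G"
  shows "left_reg G g (point_mass x) = point_mass (g \<otimes> x)"
  unfolding left_reg_eq using assms
  by (intro relabel_op_point_mass) (auto simp: inv_solve_left' cancel_inv)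

lemma right_reg_point_mass:
  assumes "k \<in> carrier G" "x \<in> carrier G"
  shows "right_reg G k (point_mass x) = point_mass (x \<otimes> k)"
  unfolding right_reg_def using assms
  by (intro relabel_op_point_mass) (auto simp: inv_solve_right' m_assoc)

section \<open>The group von Neumann algebra and its unitary group\<close>

lemma left_regs_bounded: "left_reg G ` carrier G \<subseteq> bounded_ops (carrier G)"
  using left_reg_bounded by blast

lemma commutant_left_regs_bounded:
  "commutant (carrier G) (left_reg G ` carrier G) \<subseteq> bounded_ops (carrier G)"
  by (auto simp: commutant_def)

lemma LG_bounded: "T \<in> LG G \<Longrightarrow> T \<in> bounded_ops (carrier G)"
  by (auto simp: LG_def commutant_def)

lemma LG_compose: "T \<in> LG G \<Longrightarrow> R \<in> LG G \<Longrightarrow> op_mult G T R \<in> LG G"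
  unfolding LG_def by (intro commutant_compose commutant_left_regs_bounded)

lemma LG_scalar_op: "scalar_op (carrier G) c \<in> LG G"
  unfolding LG_def by (intro scalar_op_commutant commutant_left_regs_bounded)

lemma LG_adjoint_op:
  assumes "T \<in> LG G"
  shows "adjoint_op (carrier G) T \<in> LG G"
proof -
  have "adjoint_op (carrier G) Q \<in> left_reg G ` carrier G" if "Q \<in> left_reg G ` carrier G" for Q
    using that adjoint_left_reg by auto
  then show ?thesis
    using assms unfolding LG_def
    by (intro commutant_adjoint_op commutant_left_regs_bounded left_regs_bounded)
qed

lemma LG_left_reg: "g \<in> carrier G \<Longrightarrow> left_reg G g \<in> LG G"
  by (auto simp: LG_def commutant_def left_reg_bounded)

text \<open>Right translations lie in the commutant of the left ones, hence commute with the whole algebra.\<close>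

lemma LG_right_reg_commute:
  assumes "T \<in> LG G" "k \<in> carrier G" "f \<in> ell2 (carrier G)"
  shows "T (right_reg G k f) = right_reg G k (T f)"
proof -
  have "right_reg G k \<in> commutant (carrier G) (left_reg G ` carrier G)"
    using assms(2) by (auto simp: commutant_def right_reg_bounded left_reg_right_reg_commute)
  then have "op_mult G T (right_reg G k) = op_mult G (right_reg G k) T"
    using assms(1) by (auto simp: LG_def commutant_def)
  from fun_cong[OF this, of f] show ?thesis using assms(3) by (simp add: compose_eq)
qed

text \<open>An operator of the algebra is therefore convolution with its symbol, the image of the point mass at
  the identity, and is determined by it.\<close>

lemma LG_point_mass:
  assumes "T \<in> LG G" "k \<in> carrier G"
  shows "T (point_mass k) = right_reg G k (T (delta_one G))"
  using LG_right_reg_commute[OF assms, of "delta_one G"] assms(2)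
  by (simp add: delta_one_eq point_mass_ell2 right_reg_point_mass)

lemma delta_one_ell2: "delta_one G \<in> ell2 (carrier G)"
  by (simp add: delta_one_eq point_mass_ell2)

lemma LG_separating:
  assumes "T \<in> LG G" "R \<in> LG G" "T (delta_one G) = R (delta_one G)"
  shows "T = R"
  using assms by (intro bounded_ops_ext[OF LG_bounded LG_bounded]) (simp_all add: LG_point_mass)

lemma carrier_U_LG:
  "u \<in> carrier (U_LG G) \<longleftrightarrow> u \<in> LG G \<and>
     op_mult G (adjoint_op (carrier G) u) u = scalar_op (carrier G) 1 \<and>
     op_mult G u (adjoint_op (carrier G) u) = scalar_op (carrier G) 1"
  by (simp add: U_LG_def)

lemma mult_U_LG [simp]: "mult (U_LG G) = op_mult G"
  and one_U_LG [simp]: "one (U_LG G) = scalar_op (carrier G) 1"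
  by (simp_all add: U_LG_def)

lemma U_LG_LG: "u \<in> carrier (U_LG G) \<Longrightarrow> u \<in> LG G"
  by (simp add: carrier_U_LG)

lemma U_LG_bounded: "u \<in> carrier (U_LG G) \<Longrightarrow> u \<in> bounded_ops (carrier G)"
  using U_LG_LG LG_bounded by blast

lemma U_LG_ell2: "u \<in> carrier (U_LG G) \<Longrightarrow> f \<in> ell2 (carrier G) \<Longrightarrow> u f \<in> ell2 (carrier G)"
  using U_LG_bounded bounded_opsD(1) by blast

lemma adjoint_U_LG: "u \<in> carrier (U_LG G) \<Longrightarrow> adjoint_op (carrier G) u \<in> carrier (U_LG G)"
  using adjoint_op_adjoint_op[OF U_LG_bounded] LG_adjoint_op by (simp add: carrier_U_LG)

lemma U_LG_adjoint_cancel: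
  assumes "u \<in> carrier (U_LG G)" "f \<in> ell2 (carrier G)"
  shows "adjoint_op (carrier G) u (u f) = f" "u (adjoint_op (carrier G) u f) = f"
proof -
  have "op_mult G (adjoint_op (carrier G) u) u f = scalar_op (carrier G) 1 f"
    "op_mult G u (adjoint_op (carrier G) u) f = scalar_op (carrier G) 1 f"
    using assms(1) by (simp_all add: carrier_U_LG)
  then show "adjoint_op (carrier G) u (u f) = f" "u (adjoint_op (carrier G) u f) = f"
    using assms(2) by (simp_all add: compose_eq scalar_op_def)
qed

lemma U_LG_inner:
  assumes "u \<in> carrier (U_LG G)" "f \<in> ell2 (carrier G)" "g \<in> ell2 (carrier G)"
  shows "ell2_inner (carrier G) (u f) (u g) = ell2_inner (carrier G) f g"
  using ell2_inner_adjoint_op(1)[OF U_LG_bounded[OF assms(1)] assms(2) U_LG_ell2[OF assms(1,3)]]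
    U_LG_adjoint_cancel(1)[OF assms(1,3)] by simp

lemma U_LG_norm:
  assumes "u \<in> carrier (U_LG G)" "f \<in> ell2 (carrier G)"
  shows "ell2_norm (carrier G) (u f) = ell2_norm (carrier G) f"
proof -
  have "(ell2_norm (carrier G) (u f))\<^sup>2 = (ell2_norm (carrier G) f)\<^sup>2"
    using U_LG_inner[OF assms assms(2)] ell2_inner_self[OF assms(2)]
      ell2_inner_self[OF U_LG_ell2[OF assms]] by (metis of_real_eq_iff)
  then show ?thesis by (simp add: power2_eq_iff_nonneg)
qed

lemma U_LG_mult_closed:
  assumes "u \<in> carrier (U_LG G)" "v \<in> carrier (U_LG G)"
  shows "op_mult G u v \<in> carrier (U_LG G)"
proof -
  let ?ad = "adjoint_op (carrier G)"
  have ad: "?ad (op_mult G u v) = op_mult G (?ad v) (?ad u)"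
    using assms by (intro adjoint_op_compose U_LG_bounded)
  have uv: "op_mult G u v \<in> LG G" using assms by (intro LG_compose U_LG_LG)
  note ell2 = U_LG_ell2[OF assms(1)] U_LG_ell2[OF assms(2)]
    U_LG_ell2[OF adjoint_U_LG[OF assms(1)]] U_LG_ell2[OF adjoint_U_LG[OF assms(2)]]
  have "op_mult G (?ad (op_mult G u v)) (op_mult G u v) = scalar_op (carrier G) 1"
    "op_mult G (op_mult G u v) (?ad (op_mult G u v)) = scalar_op (carrier G) 1"
    unfolding ad using assms ell2
    by (auto simp: compose_def scalar_op_def fun_eq_iff U_LG_adjoint_cancel)
  then show ?thesis using uv by (simp add: carrier_U_LG)
qed

lemma compose_scalar_op_scalar_op:
  "compose (ell2 S) (scalar_op S c) (scalar_op S d) = scalar_op S (c * d)"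
  unfolding compose_scalar_op(1)[OF scalar_op_bounded] by (auto simp: scalar_op_def fun_eq_iff)

lemma scalar_op_U_LG: "cmod c = 1 \<Longrightarrow> scalar_op (carrier G) c \<in> carrier (U_LG G)"
proof -
  assume "cmod c = 1"
  then have "c * cnj c = 1" by (simp add: complex_norm_square[symmetric])
  then have "op_mult G (scalar_op (carrier G) (cnj c)) (scalar_op (carrier G) c) = scalar_op (carrier G) 1"
    "op_mult G (scalar_op (carrier G) c) (scalar_op (carrier G) (cnj c)) = scalar_op (carrier G) 1"
    by (simp_all add: compose_scalar_op_scalar_op mult.commute)
  then show ?thesis by (simp add: carrier_U_LG LG_scalar_op adjoint_op_scalar_op)
qed

lemma left_reg_U_LG: "g \<in> carrier G \<Longrightarrow> left_reg G g \<in> carrier (U_LG G)"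
  by (simp add: carrier_U_LG LG_left_reg adjoint_left_reg left_reg_mult left_reg_one)

lemma group_U_LG: "group (U_LG G)"
proof (rule groupI)
  fix u assume u: "u \<in> carrier (U_LG G)"
  show "\<exists>v\<in>carrier (U_LG G). v \<otimes>\<^bsub>U_LG G\<^esub> u = \<one>\<^bsub>U_LG G\<^esub>"
    using u adjoint_U_LG[OF u] by (intro bexI[of _ "adjoint_op (carrier G) u"]) (auto simp: carrier_U_LG)
qed (auto simp: U_LG_mult_closed scalar_op_U_LG U_LG_bounded compose_scalar_op_1 compose_assoc_ops)

lemma inv_U_LG: "u \<in> carrier (U_LG G) \<Longrightarrow> inv\<^bsub>U_LG G\<^esub> u = adjoint_op (carrier G) u"
  by (rule group.inv_equality[OF group_U_LG]) (auto simp: adjoint_U_LG, simp add: carrier_U_LG)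

lemma circle_LG_normal: "circle_LG G \<lhd> U_LG G"
proof (rule group.normalI[OF group_U_LG])
  interpret U: group "U_LG G" by (rule group_U_LG)
  show "subgroup (circle_LG G) (U_LG G)"
  proof (rule U.subgroupI)
    show "circle_LG G \<subseteq> carrier (U_LG G)" by (auto simp: circle_LG_def scalar_op_U_LG)
    show "circle_LG G \<noteq> {}" by (auto simp: circle_LG_def intro: exI[of _ 1])
  next
    fix a assume "a \<in> circle_LG G"
    then show "inv\<^bsub>U_LG G\<^esub> a \<in> circle_LG G"
      by (auto simp: circle_LG_def inv_U_LG scalar_op_U_LG adjoint_op_scalar_op)
  next
    fix a b assume "a \<in> circle_LG G" "b \<in> circle_LG G"
    then obtain c d where "cmod c = 1" "cmod d = 1" "a = scalar_op (carrier G) c" "b = scalar_op (carrier G) d"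
      by (auto simp: circle_LG_def)
    then show "a \<otimes>\<^bsub>U_LG G\<^esub> b \<in> circle_LG G"
      by (auto simp: circle_LG_def compose_scalar_op_scalar_op norm_mult)
  qed
  show "\<forall>u\<in>carrier (U_LG G). circle_LG G #>\<^bsub>U_LG G\<^esub> u = u <#\<^bsub>U_LG G\<^esub> circle_LG G"
    by (auto simp: r_coset_def l_coset_def circle_LG_def compose_scalar_op U_LG_bounded)
qed

end

section \<open>The metric of the projective unitary group\<close>

context group
begin

abbreviation \<delta> :: "'a \<Rightarrow> complex" where "\<delta> \<equiv> delta_one G"

lemma norm2_LG_eq:
  assumes T: "T \<in> bounded_ops (carrier G)"
  shows "norm2_LG G T = ell2_norm (carrier G) (T \<delta>)"
proof -
  have T\<delta>: "T \<delta> \<in> ell2 (carrier G)" using T delta_one_ell2 by (rule bounded_opsD)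
  have "trace_LG G (op_mult G (adjoint_op (carrier G) T) T) = ell2_inner (carrier G) (T \<delta>) (T \<delta>)"
    using ell2_inner_adjoint_op(2)[OF T T\<delta> delta_one_ell2]
    by (simp add: trace_LG_def compose_eq delta_one_ell2)
  then show ?thesis by (simp add: norm2_LG_def ell2_inner_self[OF T\<delta>] del: of_real_power)
qed

lemma trace_LG_eq: "trace_LG G T = T \<delta> \<one>"
  by (simp add: trace_LG_def delta_one_eq ell2_inner_point_mass)

lemma ell2_norm_delta_one: "ell2_norm (carrier G) \<delta> = 1"
  by (simp add: delta_one_eq ell2_norm_point_mass)

lemma cmod_trace_le_1:
  assumes "u \<in> carrier (U_LG G)"
  shows "cmod (trace_LG G u) \<le> 1"
  using norm_le_ell2_norm[OF U_LG_ell2[OF assms delta_one_ell2], of \<one>]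
  by (simp add: trace_LG_eq U_LG_norm[OF assms delta_one_ell2] ell2_norm_delta_one)

lemma norm2_LG_scalar_minus:
  assumes u: "u \<in> carrier (U_LG G)"
  shows "norm2_LG G (minus_op (carrier G) (scalar_op (carrier G) c) u) =
    ell2_norm (carrier G) (\<lambda>x. c * \<delta> x - u \<delta> x)"
  using norm2_LG_eq[OF minus_op_bounded[OF scalar_op_bounded U_LG_bounded[OF u]]]
  by (simp add: minus_op_def scalar_op_def delta_one_ell2)

lemma ell2_norm_phase_diff:
  assumes f: "f \<in> ell2 (carrier G)" "ell2_norm (carrier G) f = 1"
    and g: "g \<in> ell2 (carrier G)" "ell2_norm (carrier G) g = 1" and c: "cmod c = 1"
  shows "(ell2_norm (carrier G) (\<lambda>x. c * f x - g x))\<^sup>2 = 2 - 2 * Re (c * ell2_inner (carrier G) f g)"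
  using ell2_norm_power2_diff[OF ell2_scale[OF f(1), of c] g(1)]
  by (simp add: ell2_norm_scale f g c ell2_inner_scale_left)

text \<open>The infimum defining the length is attained at the phase that makes the trace real and nonnegative.\<close>

lemma exists_optimal_phase:
  fixes z :: complex
  obtains c where "cmod c = 1" "c * z = cmod z"
proof (cases "z = 0")
  case True
  then show ?thesis using that[of 1] by simp
next
  case False
  have "cnj z / cmod z * z = cmod z"
    using False complex_norm_square[of z] by (simp add: field_simps power2_eq_square)
  then show ?thesis using that[of "cnj z / cmod z"] False by (simp add: norm_divide)
qed

lemma ell_bar_eq:
  assumes u: "u \<in> carrier (U_LG G)"
  shows "ell_bar G u = sqrt (2 * (1 - cmod (trace_LG G u)))"
proof -
  have \<delta>: "ell2_inner (carrier G) \<delta> (u \<delta>) = cnj (trace_LG G u)"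
    by (simp add: trace_LG_def ell2_inner_cnj)
  have eq: "norm2_LG G (minus_op (carrier G) (scalar_op (carrier G) c) u) =
      sqrt (2 - 2 * Re (c * cnj (trace_LG G u)))" if "cmod c = 1" for c
    using ell2_norm_phase_diff[OF delta_one_ell2 ell2_norm_delta_one U_LG_ell2[OF u delta_one_ell2] _ that]
      U_LG_norm[OF u delta_one_ell2] ell2_norm_delta_one
    unfolding norm2_LG_scalar_minus[OF u] \<delta> by (metis ell2_norm_nonneg real_sqrt_unique)
  obtain c where c: "cmod c = 1" "c * cnj (trace_LG G u) = cmod (trace_LG G u)"
    using exists_optimal_phase[of "cnj (trace_LG G u)"] by auto
  show ?thesis
    unfolding ell_bar_def
  proof (rule cInf_eq_minimum)
    show "sqrt (2 * (1 - cmod (trace_LG G u))) \<in>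
      (\<lambda>c. norm2_LG G (minus_op (carrier G) (scalar_op (carrier G) c) u)) ` {c. cmod c = 1}"
      using c by (intro image_eqI[of _ _ c]) (simp_all add: eq right_diff_distrib)
  next
    fix y assume "y \<in> (\<lambda>c. norm2_LG G (minus_op (carrier G) (scalar_op (carrier G) c) u)) ` {c. cmod c = 1}"
    then obtain d where d: "cmod d = 1" "y = sqrt (2 - 2 * Re (d * cnj (trace_LG G u)))"
      using eq by auto
    have "Re (d * cnj (trace_LG G u)) \<le> cmod (trace_LG G u)"
      using complex_Re_le_cmod[of "d * cnj (trace_LG G u)"] d(1) by (simp add: norm_mult)
    then show "sqrt (2 * (1 - cmod (trace_LG G u))) \<le> y" by (simp add: d(2))
  qed
qed

abbreviation PU_class :: "(('a \<Rightarrow> complex) \<Rightarrow> 'a \<Rightarrow> complex) \<Rightarrow> (('a \<Rightarrow> complex) \<Rightarrow> 'a \<Rightarrow> complex) set" where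
  "PU_class u \<equiv> circle_LG G #>\<^bsub>U_LG G\<^esub> u"

lemma group_PU_LG: "group (PU_LG G)"
  unfolding PU_LG_def by (rule normal.factorgroup_is_group[OF circle_LG_normal])

lemma carrier_PU_LG: "carrier (PU_LG G) = PU_class ` carrier (U_LG G)"
  by (simp add: PU_LG_def carrier_FactGroup)

lemma PU_class_mult:
  "u \<in> carrier (U_LG G) \<Longrightarrow> v \<in> carrier (U_LG G) \<Longrightarrow>
    PU_class u \<otimes>\<^bsub>PU_LG G\<^esub> PU_class v = PU_class (op_mult G u v)"
  using normal.rcos_sum[OF circle_LG_normal] by (simp add: PU_LG_def)

lemma PU_class_inv:
  assumes "u \<in> carrier (U_LG G)"
  shows "inv\<^bsub>PU_LG G\<^esub> PU_class u = PU_class (adjoint_op (carrier G) u)"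
proof -
  have "PU_class u \<in> carrier (U_LG G Mod circle_LG G)" using assms by (simp add: carrier_FactGroup)
  then show ?thesis
    using normal.inv_FactGroup[OF circle_LG_normal] normal.rcos_inv[OF circle_LG_normal assms] inv_U_LG[OF assms]
    by (simp add: PU_LG_def)
qed

lemma PU_class_eq:
  "PU_class u = {op_mult G (scalar_op (carrier G) c) u | c. cmod c = 1}"
  by (auto simp: r_coset_def circle_LG_def)

lemma PU_ell_bar_class:
  assumes u: "u \<in> carrier (U_LG G)"
  shows "PU_ell_bar G (PU_class u) = ell_bar G u"
proof -
  have "ell_bar G (op_mult G (scalar_op (carrier G) c) u) = ell_bar G u" if c: "cmod c = 1" for c
  proof -
    have "op_mult G (scalar_op (carrier G) c) u \<in> carrier (U_LG G)"
      by (intro U_LG_mult_closed scalar_op_U_LG c u)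
    moreover have "trace_LG G (op_mult G (scalar_op (carrier G) c) u) = c * trace_LG G u"
      by (simp add: trace_LG_eq compose_scalar_op U_LG_bounded[OF u] delta_one_ell2)
    ultimately show ?thesis using u c by (simp add: ell_bar_eq norm_mult)
  qed
  then have "\<forall>a\<in>PU_class u. ell_bar G a = ell_bar G u" by (auto simp: PU_class_eq)
  moreover have "PU_class u \<noteq> {}" by (auto simp: PU_class_eq intro!: exI[of _ 1])
  ultimately have "ell_bar G ` PU_class u = {ell_bar G u}" by auto
  then show ?thesis by (simp add: PU_ell_bar_def)
qed

lemma trace_adjoint_mult:
  assumes "u \<in> carrier (U_LG G)" "v \<in> carrier (U_LG G)"
  shows "trace_LG G (op_mult G (adjoint_op (carrier G) u) v) = ell2_inner (carrier G) (v \<delta>) (u \<delta>)"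
  using ell2_inner_adjoint_op(2)[OF U_LG_bounded[OF assms(1)] U_LG_ell2[OF assms(2) delta_one_ell2] delta_one_ell2]
  by (simp add: trace_LG_def compose_eq delta_one_ell2)

lemma PU_dist_class:
  assumes "u \<in> carrier (U_LG G)" "v \<in> carrier (U_LG G)"
  shows "PU_dist G (PU_class u) (PU_class v) = sqrt (2 * (1 - cmod (ell2_inner (carrier G) (u \<delta>) (v \<delta>))))"
proof -
  have "op_mult G (adjoint_op (carrier G) u) v \<in> carrier (U_LG G)"
    by (intro U_LG_mult_closed adjoint_U_LG assms)
  moreover have "PU_class u \<in> carrier (PU_LG G)" "PU_class v \<in> carrier (PU_LG G)"
    using assms by (auto simp: carrier_PU_LG)
  moreover have "cmod (ell2_inner (carrier G) (v \<delta>) (u \<delta>)) = cmod (ell2_inner (carrier G) (u \<delta>) (v \<delta>))"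
    by (metis complex_mod_cnj ell2_inner_cnj)
  ultimately show ?thesis
    using assms
    by (simp add: PU_dist_def PU_class_inv PU_class_mult adjoint_U_LG PU_ell_bar_class ell_bar_eq
        trace_adjoint_mult)
qed

text \<open>The distance of two classes is the distance of the circle orbits of their symbols; in this form the
  triangle inequality and definiteness are inherited from the norm.\<close>

lemma PU_dist_phase:
  assumes u: "u \<in> carrier (U_LG G)" and v: "v \<in> carrier (U_LG G)"
  shows "cmod c = 1 \<Longrightarrow> PU_dist G (PU_class u) (PU_class v) \<le>
      ell2_norm (carrier G) (\<lambda>x. c * u \<delta> x - v \<delta> x)"
    and "\<exists>c. cmod c = 1 \<and> PU_dist G (PU_class u) (PU_class v) =
      ell2_norm (carrier G) (\<lambda>x. c * u \<delta> x - v \<delta> x)"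
proof -
  let ?z = "ell2_inner (carrier G) (u \<delta>) (v \<delta>)"
  have eq: "ell2_norm (carrier G) (\<lambda>x. c * u \<delta> x - v \<delta> x) = sqrt (2 - 2 * Re (c * ?z))" if "cmod c = 1" for c
    using ell2_norm_phase_diff[OF U_LG_ell2[OF u delta_one_ell2] _ U_LG_ell2[OF v delta_one_ell2] _ that]
      U_LG_norm[OF u delta_one_ell2] U_LG_norm[OF v delta_one_ell2] ell2_norm_delta_one
    by (metis ell2_norm_nonneg real_sqrt_unique)
  show "PU_dist G (PU_class u) (PU_class v) \<le> ell2_norm (carrier G) (\<lambda>x. c * u \<delta> x - v \<delta> x)" if c: "cmod c = 1"
    using complex_Re_le_cmod[of "c * ?z"] c
    by (simp add: PU_dist_class[OF u v] eq[OF c] norm_mult del: times_complex.simps)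
  obtain c where "cmod c = 1" "c * ?z = cmod ?z" by (rule exists_optimal_phase)
  then show "\<exists>c. cmod c = 1 \<and> PU_dist G (PU_class u) (PU_class v) =
      ell2_norm (carrier G) (\<lambda>x. c * u \<delta> x - v \<delta> x)"
    by (intro exI[of _ c]) (simp add: PU_dist_class[OF u v] eq del: times_complex.simps)
qed

lemma PU_class_eqI:
  assumes u: "u \<in> carrier (U_LG G)" and v: "v \<in> carrier (U_LG G)" and c: "cmod c = 1"
    and eq: "v \<delta> = (\<lambda>x. c * u \<delta> x)"
  shows "PU_class u = PU_class v"
proof -
  have "v = op_mult G (scalar_op (carrier G) c) u"
    using u v by (intro LG_separating LG_compose LG_scalar_op U_LG_LG)
      (simp_all add: eq compose_scalar_op U_LG_bounded delta_one_ell2)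
  then have "v \<in> PU_class u" using c by (auto simp: PU_class_eq)
  then show ?thesis
    using group.repr_independence[OF group_U_LG _ u normal_imp_subgroup[OF circle_LG_normal]] by blast
qed

lemma Metric_space_PU: "Metric_space (carrier (PU_LG G)) (PU_dist G)"
proof
  have nonneg: "0 \<le> PU_dist G (PU_class u) (PU_class v)"
    if "u \<in> carrier (U_LG G)" "v \<in> carrier (U_LG G)" for u v
    using PU_dist_phase(2)[OF that] by auto
  show "0 \<le> PU_dist G A B" for A B
  proof (cases "A \<in> carrier (PU_LG G) \<and> B \<in> carrier (PU_LG G)")
    case True
    then show ?thesis using nonneg by (auto simp: carrier_PU_LG)
  qed (auto simp: PU_dist_def)
  show "PU_dist G A B = PU_dist G B A" for A B
  proof (cases "A \<in> carrier (PU_LG G) \<and> B \<in> carrier (PU_LG G)")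
    case True
    then obtain u v where uv: "u \<in> carrier (U_LG G)" "v \<in> carrier (U_LG G)" "A = PU_class u" "B = PU_class v"
      by (auto simp: carrier_PU_LG)
    have "cmod (ell2_inner (carrier G) (v \<delta>) (u \<delta>)) = cmod (ell2_inner (carrier G) (u \<delta>) (v \<delta>))"
      by (metis complex_mod_cnj ell2_inner_cnj)
    then show ?thesis using uv by (simp add: PU_dist_class)
  qed (auto simp: PU_dist_def)
  show "PU_dist G A B = 0 \<longleftrightarrow> A = B" if AB: "A \<in> carrier (PU_LG G)" "B \<in> carrier (PU_LG G)" for A B
  proof -
    obtain u v where u: "u \<in> carrier (U_LG G)" "A = PU_class u" and v: "v \<in> carrier (U_LG G)" "B = PU_class v"
      using AB by (auto simp: carrier_PU_LG)
    note mem = U_LG_ell2[OF u(1) delta_one_ell2] U_LG_ell2[OF v(1) delta_one_ell2]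
    show ?thesis
    proof
      assume "PU_dist G A B = 0"
      then obtain c where c: "cmod c = 1" "ell2_norm (carrier G) (\<lambda>x. c * u \<delta> x - v \<delta> x) = 0"
        using PU_dist_phase(2)[OF u(1) v(1)] u v by auto
      have "(\<lambda>x. c * u \<delta> x - v \<delta> x) = (\<lambda>_. 0)"
        using c(2) mem by (intro ell2_norm_eq_0[of _ "carrier G"] ell2_diff ell2_scale)
      then have "v \<delta> = (\<lambda>x. c * u \<delta> x)" by (simp add: fun_eq_iff)
      then show "A = B" using PU_class_eqI[OF u(1) v(1) c(1)] u v by simp
    next
      assume "A = B"
      then have "PU_dist G A B = PU_dist G (PU_class u) (PU_class u)" using u by simp
      also have "\<dots> \<le> ell2_norm (carrier G) (\<lambda>x. 1 * u \<delta> x - u \<delta> x)"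
        by (rule PU_dist_phase(1)[OF u(1) u(1)]) simp
      also have "\<dots> = 0" by (simp add: ell2_norm_def)
      finally show "PU_dist G A B = 0" using nonneg[OF u(1) v(1)] u v by simp
    qed
  qed
  show "PU_dist G A C \<le> PU_dist G A B + PU_dist G B C"
    if ABC: "A \<in> carrier (PU_LG G)" "B \<in> carrier (PU_LG G)" "C \<in> carrier (PU_LG G)" for A B C
  proof -
    obtain u v w where u: "u \<in> carrier (U_LG G)" "A = PU_class u"
      and v: "v \<in> carrier (U_LG G)" "B = PU_class v" and w: "w \<in> carrier (U_LG G)" "C = PU_class w"
      using ABC by (auto simp: carrier_PU_LG)
    note mem = U_LG_ell2[OF u(1) delta_one_ell2] U_LG_ell2[OF v(1) delta_one_ell2] U_LG_ell2[OF w(1) delta_one_ell2]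
    obtain c where c: "cmod c = 1" "PU_dist G A B = ell2_norm (carrier G) (\<lambda>x. c * u \<delta> x - v \<delta> x)"
      using PU_dist_phase(2)[OF u(1) v(1)] u v by auto
    obtain d where d: "cmod d = 1" "PU_dist G B C = ell2_norm (carrier G) (\<lambda>x. d * v \<delta> x - w \<delta> x)"
      using PU_dist_phase(2)[OF v(1) w(1)] v w by auto
    have "PU_dist G A C \<le> ell2_norm (carrier G) (\<lambda>x. (d * c) * u \<delta> x - w \<delta> x)"
      unfolding u w by (rule PU_dist_phase(1)[OF u(1) w(1)]) (simp add: norm_mult c d)
    also have "\<dots> \<le> ell2_norm (carrier G) (\<lambda>x. (d * c) * u \<delta> x - d * v \<delta> x) + PU_dist G B C"
      unfolding d(2) by (intro ell2_norm_diff_triangle ell2_scale mem)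
    also have "(\<lambda>x. (d * c) * u \<delta> x - d * v \<delta> x) = (\<lambda>x. d * (c * u \<delta> x - v \<delta> x))"
      by (simp add: right_diff_distrib mult.assoc)
    also have "ell2_norm (carrier G) \<dots> = PU_dist G A B"
      by (simp add: ell2_norm_scale d c(2))
    finally show ?thesis .
  qed
qed

lemma PU_dist_one:
  assumes "A \<in> carrier (PU_LG G)"
  shows "PU_dist G \<one>\<^bsub>PU_LG G\<^esub> A = PU_ell_bar G A"
proof -
  interpret P: group "PU_LG G" by (rule group_PU_LG)
  show ?thesis using assms by (simp add: PU_dist_def)
qed

text \<open>In a discrete set that contains the identity, some ball isolates it.\<close>

lemma not_PU_discreteI:
  assumes H: "\<one>\<^bsub>PU_LG G\<^esub> \<in> H"
    and small: "\<And>e. 0 < e \<Longrightarrow> \<exists>A\<in>H \<inter> carrier (PU_LG G). 0 < PU_ell_bar G A \<and> PU_ell_bar G A < e"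
  shows "\<not> PU_discrete G H"
proof
  interpret P: group "PU_LG G" by (rule group_PU_LG)
  interpret M: Metric_space "carrier (PU_LG G)" "PU_dist G" by (rule Metric_space_PU)
  assume "PU_discrete G H"
  then have "openin (subtopology (PU_topology G) H) {\<one>\<^bsub>PU_LG G\<^esub>}" using H by (simp add: PU_discrete_def)
  then obtain U where U: "openin (PU_topology G) U" "{\<one>\<^bsub>PU_LG G\<^esub>} = U \<inter> H"
    by (auto simp: openin_subtopology)
  then obtain e where e: "0 < e" "M.mball \<one>\<^bsub>PU_LG G\<^esub> e \<subseteq> U"
    unfolding PU_topology_def M.openin_mtopology by blast
  obtain A where A: "A \<in> H" "A \<in> carrier (PU_LG G)" "0 < PU_ell_bar G A" "PU_ell_bar G A < e"
    using small[OF e(1)] by blast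
  have "A \<in> U" using A e(2) by (auto simp: M.in_mball PU_dist_one)
  then have "A = \<one>\<^bsub>PU_LG G\<^esub>" using A(1) U(2) by blast
  then show False using A(3) PU_dist_one[OF A(2)] M.zero[OF A(2) A(2)] by simp
qed

end

section \<open>Commutators with generic conjugates\<close>

text \<open>Inclusion--exclusion for the two families of coincidences between \<open>a g k g\<^sup>-\<^sup>1\<close> and \<open>g c g\<^sup>-\<^sup>1 d\<close>: in
  either family one index is free and the two others are the identity, here \<open>i\<close>.\<close>

lemma sum_over_coincidences:
  fixes x :: "'b \<Rightarrow> complex"
  assumes F: "finite F2" "F1 \<subseteq> F2" "i \<in> F1"
  shows "(\<Sum>k\<in>F1. \<Sum>a\<in>F2. \<Sum>d\<in>F1. \<Sum>c\<in>F2. x k * x a * cnj (x d * x c) *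
      of_bool (k = i \<and> c = i \<and> a = d \<or> a = i \<and> d = i \<and> k = c)) =
    complex_of_real (2 * (cmod (x i))\<^sup>2 * (\<Sum>k\<in>F1. (cmod (x k))\<^sup>2) - (cmod (x i)) ^ 4)"
    (is "(\<Sum>k\<in>F1. \<Sum>a\<in>F2. \<Sum>d\<in>F1. \<Sum>c\<in>F2. ?t k a d c * _) = _")
proof -
  have fin: "finite F1" "i \<in> F2" using F finite_subset by auto
  \<comment> \<open>The conditions are nested so that the two innermost sums, over \<open>c\<close> and then \<open>d\<close>, meet Kronecker
    deltas first.\<close>
  have split: "?t k a d c * of_bool (k = i \<and> c = i \<and> a = d \<or> a = i \<and> d = i \<and> k = c) =
      (if c = i then if d = a then if k = i then ?t k a d c else 0 else 0 else 0)
      + (if c = k then if d = i then if a = i then ?t k a d c else 0 else 0 else 0)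
      - (if c = i then if d = i then if a = i then if k = i then ?t k a d c else 0 else 0 else 0 else 0)"
    for k a d c by auto
  have sq: "z * cnj z = complex_of_real ((cmod z)\<^sup>2)" for z by (rule complex_norm_square[symmetric])
  have N: "(\<Sum>k\<in>F1. x k * cnj (x k)) = complex_of_real (\<Sum>k\<in>F1. (cmod (x k))\<^sup>2)"
    by (simp only: sq of_real_sum)
  have "(\<Sum>k\<in>F1. \<Sum>a\<in>F2. \<Sum>d\<in>F1. \<Sum>c\<in>F2.
      if c = i then if d = a then if k = i then ?t k a d c else 0 else 0 else 0) =
    (\<Sum>a\<in>F2. \<Sum>k\<in>F1. if k = i then if a \<in> F1 then ?t k a a i else 0 else 0)"
    using fin F by (subst sum.swap) (auto intro!: sum.cong simp: sum.delta)
  also have "\<dots> = (\<Sum>a\<in>F2. if a \<in> F1 then ?t i a a i else 0)"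
    using fin F by (simp add: sum.delta)
  also have "\<dots> = (\<Sum>a\<in>F1. ?t i a a i)"
    using F by (simp add: sum.inter_restrict[symmetric] Int_absorb1)
  also have "\<dots> = (\<Sum>a\<in>F1. (x i * cnj (x i)) * (x a * cnj (x a)))"
    by (simp add: mult_ac)
  finally have 1: "(\<Sum>k\<in>F1. \<Sum>a\<in>F2. \<Sum>d\<in>F1. \<Sum>c\<in>F2.
      if c = i then if d = a then if k = i then ?t k a d c else 0 else 0 else 0) =
    (x i * cnj (x i)) * (\<Sum>k\<in>F1. x k * cnj (x k))" by (simp only: sum_distrib_left)
  have "(\<Sum>k\<in>F1. \<Sum>a\<in>F2. \<Sum>d\<in>F1. \<Sum>c\<in>F2.
      if c = k then if d = i then if a = i then ?t k a d c else 0 else 0 else 0) =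
    (\<Sum>k\<in>F1. \<Sum>a\<in>F2. if a = i then ?t k a i k else 0)"
    using fin F by (intro sum.cong[OF HOL.refl]) (auto simp: sum.delta)
  also have "\<dots> = (\<Sum>k\<in>F1. (x i * cnj (x i)) * (x k * cnj (x k)))"
    using fin F by (simp add: sum.delta mult_ac)
  finally have 2: "(\<Sum>k\<in>F1. \<Sum>a\<in>F2. \<Sum>d\<in>F1. \<Sum>c\<in>F2.
      if c = k then if d = i then if a = i then ?t k a d c else 0 else 0 else 0) =
    (x i * cnj (x i)) * (\<Sum>k\<in>F1. x k * cnj (x k))" by (simp only: sum_distrib_left)
  have 3: "(\<Sum>k\<in>F1. \<Sum>a\<in>F2. \<Sum>d\<in>F1. \<Sum>c\<in>F2.
      if c = i then if d = i then if a = i then if k = i then ?t k a d c else 0 else 0 else 0 else 0) =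
    (x i * cnj (x i)) * (x i * cnj (x i))"
    using fin F by (simp add: sum.delta mult_ac)
  show ?thesis
    unfolding split sum.distrib sum_subtractf 1 2 3 N unfolding sq
    by (simp add: power2_eq_square power4_eq_xxxx)
qed

context group
begin

text \<open>Replacing \<open>w f\<close> by a convolution of finitely supported functions. The first cut-off is harmless since
  \<open>w\<close> is isometric; the second, of the symbol of \<open>w\<close>, is amplified by the \<open>\<ell>\<^sup>1\<close>-norm of the truncated \<open>f\<close>,
  so \<open>L\<close> has to be chosen after \<open>K\<close>. The error bounds refer only to moduli and hence survive
  conjugation of the index sets.\<close>

lemma U_LG_apply_approx:
  assumes w: "w \<in> carrier (U_LG G)" and f: "f \<in> ell2 (carrier G)"
    and K: "finite K" "K \<subseteq> carrier G" and L: "finite L" "L \<subseteq> carrier G"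
    and eK: "ell2_norm (carrier G) (\<lambda>x. f x - restrict_to K f x) \<le> e"
    and eL: "(\<Sum>k\<in>K. cmod (f k)) * ell2_norm (carrier G) (\<lambda>x. w \<delta> x - restrict_to L (w \<delta>) x) \<le> e"
  shows "ell2_norm (carrier G)
    (\<lambda>x. w f x - (\<Sum>k\<in>K. \<Sum>a\<in>L. f k * w \<delta> a * point_mass (a \<otimes> k) x)) \<le> 2 * e"
proof -
  let ?S = "carrier G"
  let ?w = "w \<delta>" and ?wL = "restrict_to L (w \<delta>)"
  let ?mid = "\<lambda>x. \<Sum>k\<in>K. f k * w (point_mass k) x"
  let ?fin = "\<lambda>x. \<Sum>k\<in>K. \<Sum>a\<in>L. f k * w \<delta> a * point_mass (a \<otimes> k) x"
  have wd: "?w \<in> ell2 ?S" by (rule U_LG_ell2[OF w delta_one_ell2])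
  have wL: "?wL \<in> ell2 ?S" by (rule restrict_to_ell2[OF L(2)])
  have fK: "restrict_to K f \<in> ell2 ?S" by (rule restrict_to_ell2[OF K(2)])
  have pm: "point_mass k \<in> ell2 ?S" if "k \<in> K" for k using that K(2) by (intro point_mass_ell2) auto
  have mid: "w (restrict_to K f) = ?mid"
    unfolding restrict_to_def by (intro bounded_ops_sum[OF U_LG_bounded[OF w]] pm)
  have 1: "ell2_norm ?S (\<lambda>x. w f x - ?mid x) \<le> e"
  proof -
    have "(\<lambda>x. w f x - ?mid x) = w (\<lambda>x. f x - restrict_to K f x)"
      using bounded_ops_diff[OF U_LG_bounded[OF w] f fK] by (simp add: mid)
    then show ?thesis using U_LG_norm[OF w ell2_diff[OF f fK]] eK by simp
  qed
  have 2: "ell2_norm ?S (\<lambda>x. ?mid x - ?fin x) \<le> e"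
  proof -
    let ?r = "\<lambda>k. right_reg G k (\<lambda>x. ?w x - ?wL x)"
    have r: "?r k \<in> ell2 ?S" "ell2_norm ?S (?r k) = ell2_norm ?S (\<lambda>x. ?w x - ?wL x)" if "k \<in> K" for k
      using that K(2) ell2_diff[OF wd wL] unfolding right_reg_def
      by (intro relabel_op_ell2 bij_betw_right_mult; auto)+
    have "f k * w (point_mass k) x - (\<Sum>a\<in>L. f k * w \<delta> a * point_mass (a \<otimes> k) x) = f k * ?r k x"
      if k: "k \<in> K" for k x
    proof -
      have kG: "k \<in> ?S" using k K(2) by blast
      have "right_reg G k ?wL = (\<lambda>x. \<Sum>a\<in>L. w \<delta> a * right_reg G k (point_mass a) x)"
        unfolding restrict_to_def
        by (rule bounded_ops_sum[OF right_reg_bounded[OF kG]]) (use L in \<open>auto intro: point_mass_ell2\<close>)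
      also have "\<dots> = (\<lambda>x. \<Sum>a\<in>L. w \<delta> a * point_mass (a \<otimes> k) x)"
        using L(2) kG by (auto intro!: sum.cong simp: right_reg_point_mass fun_eq_iff)
      finally have "?r k x = w (point_mass k) x - (\<Sum>a\<in>L. w \<delta> a * point_mass (a \<otimes> k) x)"
        by (simp add: bounded_ops_diff[OF right_reg_bounded[OF kG] wd wL] LG_point_mass[OF U_LG_LG[OF w] kG])
      then show ?thesis by (simp add: right_diff_distrib sum_distrib_left mult.assoc)
    qed
    then have "(\<lambda>x. ?mid x - ?fin x) = (\<lambda>x. \<Sum>k\<in>K. f k * ?r k x)"
      by (simp add: fun_eq_iff flip: sum_subtractf)
    then have "ell2_norm ?S (\<lambda>x. ?mid x - ?fin x) \<le> (\<Sum>k\<in>K. ell2_norm ?S (\<lambda>x. f k * ?r k x))"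
      using ell2_sum(2)[of K "\<lambda>k x. f k * ?r k x" ?S] ell2_scale[OF r(1)] by simp
    also have "\<dots> = (\<Sum>k\<in>K. cmod (f k)) * ell2_norm ?S (\<lambda>x. ?w x - ?wL x)"
      by (simp add: ell2_norm_scale r(2) sum_distrib_right)
    finally show ?thesis using eL by simp
  qed
  have "?mid \<in> ell2 ?S" by (intro ell2_sum ell2_scale U_LG_ell2[OF w] pm)
  moreover have "?fin \<in> ell2 ?S" using K(2) L(2) by (intro ell2_sum ell2_scale point_mass_ell2) auto
  ultimately show ?thesis
    using ell2_norm_diff_triangle[OF U_LG_ell2[OF w f]] 1 2 by fastforce
qed

definition conjugate_op :: "'a \<Rightarrow> (('a \<Rightarrow> complex) \<Rightarrow> 'a \<Rightarrow> complex) \<Rightarrow> ('a \<Rightarrow> complex) \<Rightarrow> 'a \<Rightarrow> complex" where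
  "conjugate_op g u = op_mult G (op_mult G (left_reg G g) u) (left_reg G (inv g))"

lemma conjugate_op_U_LG:
  "g \<in> carrier G \<Longrightarrow> u \<in> carrier (U_LG G) \<Longrightarrow> conjugate_op g u \<in> carrier (U_LG G)"
  unfolding conjugate_op_def by (intro U_LG_mult_closed left_reg_U_LG) auto

lemma adjoint_conjugate_op:
  assumes g: "g \<in> carrier G" and u: "u \<in> carrier (U_LG G)"
  shows "adjoint_op (carrier G) (conjugate_op g u) = conjugate_op g (adjoint_op (carrier G) u)"
proof -
  have b: "left_reg G g \<in> bounded_ops (carrier G)" "left_reg G (inv g) \<in> bounded_ops (carrier G)"
    "u \<in> bounded_ops (carrier G)" "adjoint_op (carrier G) u \<in> bounded_ops (carrier G)"
    using g u by (auto intro: left_reg_bounded U_LG_bounded adjoint_U_LG)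
  then show ?thesis
    using g unfolding conjugate_op_def
    by (simp add: adjoint_op_compose compose_bounded_ops adjoint_left_reg compose_assoc_ops)
qed

lemma conjugate_op_delta:
  assumes g: "g \<in> carrier G" and u: "u \<in> carrier (U_LG G)" and x: "x \<in> carrier G"
  shows "conjugate_op g u \<delta> (g \<otimes> x \<otimes> inv g) = u \<delta> x"
proof -
  have ud: "u \<delta> \<in> ell2 (carrier G)" by (rule U_LG_ell2[OF u delta_one_ell2])
  have "left_reg G (inv g) \<delta> = point_mass (inv g)"
    using g by (simp add: delta_one_eq left_reg_point_mass)
  then have "conjugate_op g u \<delta> = left_reg G g (right_reg G (inv g) (u \<delta>))"
    using g ud LG_point_mass[OF U_LG_LG[OF u], of "inv g"] point_mass_ell2[of "inv g" "carrier G"]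
    by (simp add: conjugate_op_def compose_eq delta_one_ell2)
  moreover have "right_reg G (inv g) (u \<delta>) \<in> ell2 (carrier G)"
    using g ud by (intro bounded_opsD(1)[OF right_reg_bounded]) auto
  ultimately show ?thesis
    using g x ud by (simp add: left_reg_def right_reg_def relabel_op_def m_assoc cancel_inv)
qed

lemma trace_commutator:
  assumes u: "u \<in> carrier (U_LG G)" and v: "v \<in> carrier (U_LG G)"
  shows "trace_LG G (op_mult G (op_mult G u v) (op_mult G (adjoint_op (carrier G) u) (adjoint_op (carrier G) v))) =
    ell2_inner (carrier G) (adjoint_op (carrier G) u (adjoint_op (carrier G) v \<delta>))
      (adjoint_op (carrier G) v (adjoint_op (carrier G) u \<delta>))"
proof -
  let ?p = "adjoint_op (carrier G) u (adjoint_op (carrier G) v \<delta>)"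
  have p: "?p \<in> ell2 (carrier G)" "adjoint_op (carrier G) v \<delta> \<in> ell2 (carrier G)"
    "adjoint_op (carrier G) u \<delta> \<in> ell2 (carrier G)"
    using U_LG_ell2[OF adjoint_U_LG[OF u]] U_LG_ell2[OF adjoint_U_LG[OF v]] delta_one_ell2 by blast+
  have "trace_LG G (op_mult G (op_mult G u v) (op_mult G (adjoint_op (carrier G) u) (adjoint_op (carrier G) v))) =
    ell2_inner (carrier G) (u (v ?p)) \<delta>"
    using p by (simp add: trace_LG_def compose_eq delta_one_ell2)
  also have "\<dots> = ell2_inner (carrier G) (v ?p) (adjoint_op (carrier G) u \<delta>)"
    by (rule ell2_inner_adjoint_op(1)[OF U_LG_bounded[OF u] U_LG_ell2[OF v p(1)] delta_one_ell2])
  also have "\<dots> = ell2_inner (carrier G) ?p (adjoint_op (carrier G) v (adjoint_op (carrier G) u \<delta>))"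
    by (rule ell2_inner_adjoint_op(1)[OF U_LG_bounded[OF v] p(1,3)])
  finally show ?thesis .
qed

lemma ell2_inner_close:
  assumes "p \<in> ell2 S" "q \<in> ell2 S" "A \<in> ell2 S" "B \<in> ell2 S"
    and "ell2_norm S q \<le> 1" "ell2_norm S p \<le> 1"
    and "ell2_norm S (\<lambda>x. p x - A x) \<le> e" "ell2_norm S (\<lambda>x. q x - B x) \<le> e"
  shows "cmod (ell2_inner S p q - ell2_inner S A B) \<le> e + (1 + e) * e"
proof -
  let ?pA = "\<lambda>x. p x - A x" and ?qB = "\<lambda>x. q x - B x"
  have e: "0 \<le> e" using assms(7) ell2_norm_nonneg[of S ?pA] by linarith
  have d: "?pA \<in> ell2 S" "?qB \<in> ell2 S" by (intro ell2_diff assms)+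
  have "ell2_norm S A \<le> ell2_norm S (\<lambda>x. A x - p x) + ell2_norm S p"
    using ell2_norm_diff_triangle[OF assms(3,1) ell2_zero] by simp
  then have A: "ell2_norm S A \<le> 1 + e"
    using assms(6,7) ell2_norm_diff_commute[of S A p] by linarith
  have "ell2_inner S p q - ell2_inner S A B = ell2_inner S ?pA q + ell2_inner S A ?qB"
    using assms by (simp add: ell2_inner_diff_left ell2_inner_diff_right)
  then have "cmod (ell2_inner S p q - ell2_inner S A B) \<le> cmod (ell2_inner S ?pA q) + cmod (ell2_inner S A ?qB)"
    by (simp add: norm_triangle_ineq)
  also have "\<dots> \<le> ell2_norm S ?pA * ell2_norm S q + ell2_norm S A * ell2_norm S ?qB"
    by (intro add_mono ell2_Cauchy_Schwarz d assms)
  also have "\<dots> \<le> e * 1 + (1 + e) * e"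
    using e by (intro add_mono mult_mono assms A) auto
  finally show ?thesis by simp
qed

text \<open>This is the value that freeness of the operator and its conjugate would give. The index sets
  \<open>F1\<close> and \<open>F2\<close> of the approximation are fixed first, and \<open>g\<close> is chosen generic for \<open>F2\<close> afterwards.\<close>

lemma trace_generic_commutator:
  assumes MIF: "MIF G" and u: "u \<in> carrier (U_LG G)" and e: "0 < e"
  shows "\<exists>g\<in>carrier G. \<bar>cmod (trace_LG G (op_mult G (op_mult G u (conjugate_op g u))
      (op_mult G (adjoint_op (carrier G) u) (adjoint_op (carrier G) (conjugate_op g u)))))
    - (1 - (1 - (cmod (trace_LG G u))\<^sup>2)\<^sup>2)\<bar> \<le> e"
proof -
  let ?S = "carrier G"
  let ?ad = "adjoint_op ?S"
  \<comment> \<open>The approximation of both vectors costs \<open>8 \<epsilon>\<close>, the loss of norm in the truncated \<open>\<xi>\<close> another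
    \<open>2 \<epsilon>\<close>.\<close>
  define \<epsilon> where "\<epsilon> = min 1 (e / 10)"
  have \<epsilon>: "0 < \<epsilon>" "\<epsilon> \<le> 1" "10 * \<epsilon> \<le> e" using e by (auto simp: \<epsilon>_def)
  define \<xi> where "\<xi> = ?ad u \<delta>"
  have u': "?ad u \<in> carrier (U_LG G)" by (rule adjoint_U_LG[OF u])
  have \<xi>: "\<xi> \<in> ell2 ?S" "ell2_norm ?S \<xi> = 1"
    using U_LG_ell2[OF u' delta_one_ell2] U_LG_norm[OF u' delta_one_ell2]
    by (simp_all add: \<xi>_def ell2_norm_delta_one)
  define t where "t = cmod (trace_LG G u)"
  have t: "0 \<le> t" "t \<le> 1" "cmod (\<xi> \<one>) = t"
  proof -
    have "\<xi> \<one> = ell2_inner ?S \<xi> \<delta>"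
      by (simp add: delta_one_eq ell2_inner_point_mass)
    also have "\<dots> = ell2_inner ?S \<delta> (u \<delta>)"
      unfolding \<xi>_def by (rule ell2_inner_adjoint_op(2)[OF U_LG_bounded[OF u] delta_one_ell2 delta_one_ell2])
    also have "\<dots> = cnj (trace_LG G u)"
      by (simp add: trace_LG_def ell2_inner_cnj)
    finally show "cmod (\<xi> \<one>) = t" by (simp add: t_def)
  qed (use cmod_trace_le_1[OF u] in \<open>auto simp: t_def\<close>)
  obtain F1 where F1: "finite F1" "\<one> \<in> F1" "F1 \<subseteq> ?S"
    "ell2_norm ?S (\<lambda>x. \<xi> x - restrict_to F1 \<xi> x) \<le> \<epsilon>"
    using ell2_restrict_to_approx[OF \<xi>(1) \<epsilon>(1), of "{\<one>}"] by auto
  define M where "M = (\<Sum>k\<in>F1. cmod (\<xi> k))"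
  have M: "0 \<le> M" by (simp add: M_def sum_nonneg)
  obtain F2 where F2: "finite F2" "F1 \<subseteq> F2" "F2 \<subseteq> ?S"
    "ell2_norm ?S (\<lambda>x. \<xi> x - restrict_to F2 \<xi> x) \<le> \<epsilon> / (M + 1)"
    using ell2_restrict_to_approx[OF \<xi>(1), of "\<epsilon> / (M + 1)" F1] \<epsilon> M F1 by auto
  have F2': "M * ell2_norm ?S (\<lambda>x. \<xi> x - restrict_to F2 \<xi> x) \<le> \<epsilon>"
  proof -
    have "M * ell2_norm ?S (\<lambda>x. \<xi> x - restrict_to F2 \<xi> x) \<le> (M + 1) * (\<epsilon> / (M + 1))"
      using M by (intro mult_mono F2) auto
    then show ?thesis using M by simp
  qed
  from MIF_exists_conjugator[OF MIF F2(1,3)]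
  obtain g where g: "g \<in> ?S" and "\<forall>a\<in>F2. \<forall>b\<in>F2. \<forall>c\<in>F2. \<forall>d\<in>F2.
      a \<otimes> (g \<otimes> b \<otimes> inv g) = g \<otimes> c \<otimes> inv g \<otimes> d \<longleftrightarrow> b = \<one> \<and> c = \<one> \<and> a = d \<or> a = \<one> \<and> d = \<one> \<and> b = c" ..
  note generic = this(2)[rule_format]
  define v where "v = conjugate_op g u"
  have v: "v \<in> carrier (U_LG G)" "?ad v \<in> carrier (U_LG G)"
    using conjugate_op_U_LG[OF g u] adjoint_U_LG by (simp_all add: v_def)
  define \<eta> where "\<eta> = ?ad v \<delta>"
  let ?c = "\<lambda>x. g \<otimes> x \<otimes> inv g"
  have \<eta>: "\<eta> \<in> ell2 ?S" "ell2_norm ?S \<eta> = 1"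
    using U_LG_ell2[OF v(2) delta_one_ell2] U_LG_norm[OF v(2) delta_one_ell2]
    by (simp_all add: \<eta>_def ell2_norm_delta_one)
  have \<eta>_c: "\<eta> (?c x) = \<xi> x" if "x \<in> ?S" for x
    using conjugate_op_delta[OF g u' that] adjoint_conjugate_op[OF g u] by (simp add: \<eta>_def v_def \<xi>_def)
  have inj: "inj_on ?c F" if "F \<subseteq> ?S" for F
    using that g by (intro inj_onI) (auto simp: subset_iff)
  have c_mem: "?c ` F \<subseteq> ?S" if "F \<subseteq> ?S" for F using that g by auto
  have \<eta>_approx: "ell2_norm ?S (\<lambda>x. \<eta> x - restrict_to (?c ` F) \<eta> x) = ell2_norm ?S (\<lambda>x. \<xi> x - restrict_to F \<xi> x)"
    if F: "finite F" "F \<subseteq> ?S" for F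
  proof -
    have "(\<Sum>k\<in>?c ` F. (cmod (\<eta> k))\<^sup>2) = (\<Sum>k\<in>F. (cmod (\<xi> k))\<^sup>2)"
      using F \<eta>_c by (subst sum.reindex[OF inj[OF F(2)]]) (auto intro!: sum.cong)
    then have "(ell2_norm ?S (\<lambda>x. \<eta> x - restrict_to (?c ` F) \<eta> x))\<^sup>2 =
      (ell2_norm ?S (\<lambda>x. \<xi> x - restrict_to F \<xi> x))\<^sup>2"
      using ell2_norm_diff_restrict_to[OF \<xi>(1) F]
        ell2_norm_diff_restrict_to[OF \<eta>(1) finite_imageI[OF F(1)] c_mem[OF F(2)]] \<xi>(2) \<eta>(2) by simp
    then show ?thesis by (simp add: power2_eq_iff_nonneg)
  qed
  define A where "A = (\<lambda>x. \<Sum>k\<in>F1. \<Sum>a\<in>F2. \<xi> k * \<xi> a * point_mass (a \<otimes> ?c k) x)"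
  define B where "B = (\<lambda>x. \<Sum>d\<in>F1. \<Sum>c\<in>F2. \<xi> d * \<xi> c * point_mass (?c c \<otimes> d) x)"
  note F1S = F1(3)
  have mem: "a \<in> ?S" "?c a \<in> ?S" if "a \<in> F2" for a using that F2(3) g by auto
  have mem1: "a \<in> ?S" "?c a \<in> ?S" "a \<in> F2" if "a \<in> F1" for a using that F1(3) F2(2) g by auto
  have pA: "ell2_norm ?S (\<lambda>x. ?ad u \<eta> x - A x) \<le> 2 * \<epsilon>"
  proof -
    have "M = (\<Sum>k\<in>?c ` F1. cmod (\<eta> k))"
      unfolding M_def using \<eta>_c F1(3) by (subst sum.reindex[OF inj[OF F1(3)]]) (auto intro!: sum.cong)
    then have "ell2_norm ?S (\<lambda>x. ?ad u \<eta> x -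
        (\<Sum>k\<in>?c ` F1. \<Sum>a\<in>F2. \<eta> k * ?ad u \<delta> a * point_mass (a \<otimes> k) x)) \<le> 2 * \<epsilon>"
      using F1 F2 F2' \<eta>_approx[OF F1(1,3)]
      by (intro U_LG_apply_approx u' \<eta> finite_imageI c_mem) (simp_all add: \<xi>_def)
    also have "(\<lambda>x. \<Sum>k\<in>?c ` F1. \<Sum>a\<in>F2. \<eta> k * ?ad u \<delta> a * point_mass (a \<otimes> k) x) = A"
      using \<eta>_c F1(3) unfolding A_def \<xi>_def[symmetric]
      by (subst sum.reindex[OF inj[OF F1(3)]]) (auto intro!: sum.cong simp: fun_eq_iff)
    finally show ?thesis .
  qed
  have qB: "ell2_norm ?S (\<lambda>x. ?ad v \<xi> x - B x) \<le> 2 * \<epsilon>"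
  proof -
    have "ell2_norm ?S (\<lambda>x. ?ad v \<xi> x -
        (\<Sum>d\<in>F1. \<Sum>c\<in>?c ` F2. \<xi> d * ?ad v \<delta> c * point_mass (c \<otimes> d) x)) \<le> 2 * \<epsilon>"
      using F1 F2 F2' \<eta>_approx[OF F2(1,3)]
      by (intro U_LG_apply_approx v \<xi> finite_imageI c_mem) (simp_all add: \<eta>_def M_def)
    also have "(\<lambda>x. \<Sum>d\<in>F1. \<Sum>c\<in>?c ` F2. \<xi> d * ?ad v \<delta> c * point_mass (c \<otimes> d) x) = B"
      using \<eta>_c F2(3) unfolding B_def \<eta>_def[symmetric]
      by (subst sum.reindex[OF inj[OF F2(3)]]) (auto intro!: sum.cong simp: fun_eq_iff)
    finally show ?thesis .
  qed
  \<comment> \<open>The identity lies in \<open>F1\<close>, so truncation affects the result only through the norm of \<open>\<xi>\<close>.\<close>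
  define N where "N = (\<Sum>k\<in>F1. (cmod (\<xi> k))\<^sup>2)"
  have N: "1 - \<epsilon> \<le> N" "N \<le> 1"
  proof -
    have *: "(ell2_norm ?S (\<lambda>x. \<xi> x - restrict_to F1 \<xi> x))\<^sup>2 = 1 - N"
      using ell2_norm_diff_restrict_to[OF \<xi>(1) F1(1,3)] \<xi>(2) by (simp add: N_def)
    then show "N \<le> 1" by (metis diff_ge_0_iff_ge zero_le_power2)
    have "1 - N \<le> \<epsilon>\<^sup>2" unfolding *[symmetric] by (intro power_mono F1) simp
    also have "\<dots> \<le> \<epsilon>" using \<epsilon> by (simp add: power2_eq_square mult_left_le)
    finally show "1 - \<epsilon> \<le> N" by simp
  qed
  have AB: "ell2_inner ?S A B = complex_of_real (2 * t\<^sup>2 * N - t ^ 4)"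
  proof -
    have pm: "ell2_inner ?S (point_mass y) (point_mass z) = of_bool (y = z)" if "z \<in> ?S" for y z
      using that by (simp add: ell2_inner_point_mass) (simp add: point_mass_def)
    have B2: "(\<lambda>x. \<Sum>c\<in>F2. \<xi> d * \<xi> c * point_mass (?c c \<otimes> d) x) \<in> ell2 ?S" if "d \<in> F1" for d
      using that mem mem1 by (intro ell2_sum ell2_scale point_mass_ell2) auto
    have B: "B \<in> ell2 ?S" unfolding B_def by (intro ell2_sum B2)
    have "ell2_inner ?S A B =
      (\<Sum>k\<in>F1. ell2_inner ?S (\<lambda>x. \<Sum>a\<in>F2. \<xi> k * \<xi> a * point_mass (a \<otimes> ?c k) x) B)"
      unfolding A_def using mem mem1
      by (intro ell2_inner_sum_left B ell2_sum ell2_scale point_mass_ell2) auto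
    also have "\<dots> = (\<Sum>k\<in>F1. \<Sum>a\<in>F2. ell2_inner ?S (\<lambda>x. \<xi> k * \<xi> a * point_mass (a \<otimes> ?c k) x) B)"
      using mem mem1 by (intro sum.cong[OF HOL.refl] ell2_inner_sum_left B ell2_scale point_mass_ell2) auto
    also have "\<dots> = (\<Sum>k\<in>F1. \<Sum>a\<in>F2. \<Sum>d\<in>F1. \<Sum>c\<in>F2. \<xi> k * \<xi> a * cnj (\<xi> d * \<xi> c) *
      of_bool (k = \<one> \<and> c = \<one> \<and> a = d \<or> a = \<one> \<and> d = \<one> \<and> k = c))"
    proof (intro sum.cong[OF HOL.refl])
      fix k a assume k: "k \<in> F1" and a: "a \<in> F2"
      have f: "point_mass (a \<otimes> ?c k) \<in> ell2 ?S" using mem mem1 k a by (intro point_mass_ell2) auto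
      have "ell2_inner ?S (point_mass (a \<otimes> ?c k)) B =
        (\<Sum>d\<in>F1. ell2_inner ?S (point_mass (a \<otimes> ?c k)) (\<lambda>x. \<Sum>c\<in>F2. \<xi> d * \<xi> c * point_mass (?c c \<otimes> d) x))"
        unfolding B_def by (intro ell2_inner_sum_right B2 f)
      also have "\<dots> = (\<Sum>d\<in>F1. \<Sum>c\<in>F2. ell2_inner ?S (point_mass (a \<otimes> ?c k)) (\<lambda>x. \<xi> d * \<xi> c * point_mass (?c c \<otimes> d) x))"
        using mem mem1 by (intro sum.cong[OF HOL.refl] ell2_inner_sum_right f ell2_scale point_mass_ell2) auto
      also have "\<dots> = (\<Sum>d\<in>F1. \<Sum>c\<in>F2. cnj (\<xi> d * \<xi> c) *
          of_bool (k = \<one> \<and> c = \<one> \<and> a = d \<or> a = \<one> \<and> d = \<one> \<and> k = c))"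
        using mem mem1 generic k a by (intro sum.cong[OF HOL.refl]) (simp add: ell2_inner_scale_right pm)
      finally show "ell2_inner ?S (\<lambda>x. \<xi> k * \<xi> a * point_mass (a \<otimes> ?c k) x) B = (\<Sum>d\<in>F1. \<Sum>c\<in>F2. \<xi> k * \<xi> a *
          cnj (\<xi> d * \<xi> c) * of_bool (k = \<one> \<and> c = \<one> \<and> a = d \<or> a = \<one> \<and> d = \<one> \<and> k = c))"
        by (simp add: ell2_inner_scale_left sum_distrib_left mult.assoc)
    qed
    also have "\<dots> = complex_of_real (2 * t\<^sup>2 * N - t ^ 4)"
      unfolding N_def t(3)[symmetric] by (rule sum_over_coincidences[OF F2(1,2) F1(2)])
    finally show ?thesis .
  qed
  let ?T = "trace_LG G (op_mult G (op_mult G u v) (op_mult G (?ad u) (?ad v)))"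
  have "cmod (?T - ell2_inner ?S A B) \<le> 2 * \<epsilon> + (1 + 2 * \<epsilon>) * (2 * \<epsilon>)"
    unfolding trace_commutator[OF u v(1)] \<eta>_def[symmetric] \<xi>_def[symmetric]
  proof (rule ell2_inner_close[OF _ _ _ _ _ _ pA qB])
    show "A \<in> ell2 ?S" "B \<in> ell2 ?S" unfolding A_def B_def using mem mem1
      by (intro ell2_sum ell2_scale point_mass_ell2; auto)+
  qed (use \<xi> \<eta> in \<open>simp_all add: U_LG_ell2[OF u'] U_LG_ell2[OF v(2)] U_LG_norm[OF u'] U_LG_norm[OF v(2)]\<close>)
  also have "\<dots> \<le> 8 * \<epsilon>"
    using mult_left_mono[OF \<epsilon>(2), of "4 * \<epsilon>"] \<epsilon>(1) by (simp add: algebra_simps)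
  finally have 1: "cmod (?T - complex_of_real (2 * t\<^sup>2 * N - t ^ 4)) \<le> 8 * \<epsilon>" by (simp add: AB)
  have t2: "0 \<le> t\<^sup>2" "t\<^sup>2 \<le> 1" using t by (auto simp: power_le_one)
  have "2 * t\<^sup>2 * N - t ^ 4 - (1 - (1 - t\<^sup>2)\<^sup>2) = - (2 * t\<^sup>2 * (1 - N))"
    by (simp add: power2_eq_square power4_eq_xxxx algebra_simps)
  then have "\<bar>2 * t\<^sup>2 * N - t ^ 4 - (1 - (1 - t\<^sup>2)\<^sup>2)\<bar> = 2 * t\<^sup>2 * (1 - N)"
    using N t2 by simp
  also have "\<dots> \<le> 2 * 1 * \<epsilon>" using N t2 by (intro mult_mono) auto
  finally have 2: "\<bar>2 * t\<^sup>2 * N - t ^ 4 - (1 - (1 - t\<^sup>2)\<^sup>2)\<bar> \<le> 2 * \<epsilon>" by simp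
  have nonneg: "0 \<le> 1 - (1 - t\<^sup>2)\<^sup>2" using t2 by (simp add: power_le_one)
  have "cmod (?T - complex_of_real (1 - (1 - t\<^sup>2)\<^sup>2)) \<le>
    cmod (?T - complex_of_real (2 * t\<^sup>2 * N - t ^ 4)) +
    cmod (complex_of_real (2 * t\<^sup>2 * N - t ^ 4) - complex_of_real (1 - (1 - t\<^sup>2)\<^sup>2))"
    using dist_triangle[of ?T "complex_of_real (1 - (1 - t\<^sup>2)\<^sup>2)" "complex_of_real (2 * t\<^sup>2 * N - t ^ 4)"]
    by (simp only: dist_norm)
  also have "\<dots> \<le> 8 * \<epsilon> + 2 * \<epsilon>"
    using 1 2 by (intro add_mono) (simp_all only: norm_of_real flip: of_real_diff)
  finally have "cmod (?T - complex_of_real (1 - (1 - t\<^sup>2)\<^sup>2)) \<le> e" using \<epsilon> by linarith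
  then have "\<bar>cmod ?T - cmod (complex_of_real (1 - (1 - t\<^sup>2)\<^sup>2))\<bar> \<le> e"
    using norm_triangle_ineq3 order_trans by blast
  then have "\<bar>cmod ?T - (1 - (1 - t\<^sup>2)\<^sup>2)\<bar> \<le> e"
    using nonneg by (simp only: norm_of_real abs_of_nonneg)
  then show ?thesis using g by (auto simp: v_def t_def)
qed

end

section \<open>Non-discreteness\<close>

context group
begin

text \<open>With \<open>t = \<bar>\<tau>(u)\<bar>\<close> the commutator has parameter close to \<open>(1 - t\<^sup>2)\<^sup>2 = (1 - t)\<^sup>2 (1 + t)\<^sup>2\<close>. Since \<open>t < 1\<close>, this is strictly
  between \<open>0\<close> and \<open>4 (1 - t)\<^sup>2\<close>, and the error can be chosen so that both inequalities survive.\<close>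

lemma exists_shorter_commutator:
  assumes MIF: "MIF G" and K: "subgroup K (PU_LG G)" "PU_embed G ` carrier G \<subseteq> K"
    and u: "u \<in> carrier (U_LG G)" "PU_class u \<in> K"
    and s: "0 < 1 - cmod (trace_LG G u)" "1 - cmod (trace_LG G u) < 1 / 4"
  shows "\<exists>w\<in>carrier (U_LG G). PU_class w \<in> K \<and> 0 < 1 - cmod (trace_LG G w) \<and>
    1 - cmod (trace_LG G w) < 4 * (1 - cmod (trace_LG G u))\<^sup>2"
proof -
  interpret K: subgroup K "PU_LG G" by (rule K(1))
  define t where "t = cmod (trace_LG G u)"
  define l where "l = (1 - t\<^sup>2)\<^sup>2"
  have t: "3 / 4 < t" "t < 1" using s by (auto simp: t_def)
  have factor: "l = (1 - t)\<^sup>2 * (1 + t)\<^sup>2" by (simp add: l_def power2_eq_square algebra_simps)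
  have l: "0 < l" "l < 4 * (1 - t)\<^sup>2"
  proof -
    show "0 < l" using t by (simp add: factor)
    have "(1 + t)\<^sup>2 < 2\<^sup>2" using t by (intro power_strict_mono) auto
    then show "l < 4 * (1 - t)\<^sup>2" using t by (simp add: factor)
  qed
  define e where "e = min l (4 * (1 - t)\<^sup>2 - l) / 2"
  have e: "0 < e" "e < l" "l + e < 4 * (1 - t)\<^sup>2"
    using l by (auto simp: e_def min_def field_simps)
  let ?ad = "adjoint_op (carrier G)"
  obtain g where g: "g \<in> carrier G" and
    "\<bar>cmod (trace_LG G (op_mult G (op_mult G u (conjugate_op g u)) (op_mult G (?ad u) (?ad (conjugate_op g u)))))
      - (1 - l)\<bar> \<le> e"
    using trace_generic_commutator[OF MIF u(1) e(1)] by (auto simp: t_def l_def)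
  moreover define v where "v = conjugate_op g u"
  moreover define w where "w = op_mult G (op_mult G u v) (op_mult G (?ad u) (?ad v))"
  ultimately have w: "\<bar>cmod (trace_LG G w) - (1 - l)\<bar> \<le> e" by simp
  have U: "v \<in> carrier (U_LG G)" "?ad u \<in> carrier (U_LG G)" "?ad v \<in> carrier (U_LG G)"
    using conjugate_op_U_LG[OF g u(1)] u(1) by (simp_all add: v_def adjoint_U_LG)
  have embed: "PU_class (left_reg G h) \<in> K" if "h \<in> carrier G" for h
    using K(2) that by (auto simp: PU_embed_def)
  have mult: "PU_class (op_mult G a b) \<in> K"
    if "PU_class a \<in> K" "PU_class b \<in> K" "a \<in> carrier (U_LG G)" "b \<in> carrier (U_LG G)" for a b
    using K.m_closed[OF that(1,2)] PU_class_mult[OF that(3,4)] by simp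
  have ad: "PU_class (?ad a) \<in> K" if "PU_class a \<in> K" "a \<in> carrier (U_LG G)" for a
    using K.m_inv_closed[OF that(1)] PU_class_inv[OF that(2)] by simp
  have "PU_class v \<in> K"
    unfolding v_def conjugate_op_def using g u
    by (intro mult embed U_LG_mult_closed left_reg_U_LG) auto
  then have "PU_class w \<in> K"
    unfolding w_def using u U by (intro mult ad U_LG_mult_closed)
  moreover have "w \<in> carrier (U_LG G)" unfolding w_def using u U by (intro U_LG_mult_closed)
  moreover have "0 < 1 - cmod (trace_LG G w)" "1 - cmod (trace_LG G w) < 4 * (1 - cmod (trace_LG G u))\<^sup>2"
    using w e unfolding t_def[symmetric] by linarith+
  ultimately show ?thesis by blast
qed

text \<open>In every step \<open>4 s\<close> becomes smaller than its square, so starting below \<open>1\<close> it decays to \<open>0\<close> while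
  remaining positive; a geometric bound suffices.\<close>

lemma not_PU_discrete_if_short:
  assumes MIF: "MIF G" and K: "subgroup K (PU_LG G)" "PU_embed G ` carrier G \<subseteq> K"
    and A: "A \<in> K" "0 < PU_ell_bar G A" "PU_ell_bar G A < 1 / sqrt 2"
  shows "\<not> PU_discrete G K"
proof -
  interpret K: subgroup K "PU_LG G" by (rule K(1))
  define s where "s = (\<lambda>u. 1 - cmod (trace_LG G u))"
  have length: "PU_ell_bar G (PU_class w) = sqrt (2 * s w)" if "w \<in> carrier (U_LG G)" for w
    using that by (simp add: PU_ell_bar_class ell_bar_eq s_def)
  have shorter: "\<exists>w'\<in>carrier (U_LG G). PU_class w' \<in> K \<and> 0 < s w' \<and> s w' < 4 * (s w)\<^sup>2"
    if "w \<in> carrier (U_LG G)" "PU_class w \<in> K" "0 < s w" "s w < 1 / 4" for w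
    using exists_shorter_commutator[OF MIF K that[unfolded s_def]] unfolding s_def .
  obtain u where u: "u \<in> carrier (U_LG G)" "A = PU_class u"
    using A(1) K.subset by (auto simp: carrier_PU_LG)
  have "sqrt (2 * s u) < sqrt (1 / 2)"
    using A(3) u by (simp add: length real_sqrt_divide)
  moreover have "0 < sqrt (2 * s u)"
    using A(2) u by (simp add: length)
  ultimately have su: "0 < s u" "s u < 1 / 4" by auto
  define q where "q = 4 * s u"
  have q: "0 < q" "q < 1" using su by (auto simp: q_def)
  have short: "\<exists>w\<in>carrier (U_LG G). PU_class w \<in> K \<and> 0 < s w \<and> 4 * s w \<le> q ^ Suc n" for n
  proof (induction n)
    case 0
    then show ?case using u A(1) su by (intro bexI[of _ u]) (auto simp: q_def)
  next
    case (Suc n)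
    then obtain w where w: "w \<in> carrier (U_LG G)" "PU_class w \<in> K" "0 < s w" "4 * s w \<le> q ^ Suc n" by blast
    have le: "q ^ Suc n \<le> q" using q power_decreasing[of 1 "Suc n" q] by simp
    have wq: "4 * s w \<le> q" by (rule order.trans[OF w(4) le])
    have "s w < 1 / 4" using order.strict_trans1[OF wq q(2)] by simp
    then obtain w' where w': "w' \<in> carrier (U_LG G)" "PU_class w' \<in> K" "0 < s w'" "s w' < 4 * (s w)\<^sup>2"
      using shorter[OF w(1,2,3)] by blast
    have "4 * s w' \<le> 4 * (4 * (s w)\<^sup>2)" using w'(4) by simp
    also have "\<dots> = (4 * s w) * (4 * s w)" by (simp only: power2_eq_square mult_ac)
    also have "\<dots> \<le> q * q ^ Suc n" using q w(3) by (intro mult_mono wq w(4)) auto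
    finally show ?case using w' by auto
  qed
  show ?thesis
  proof (rule not_PU_discreteI)
    show "\<one>\<^bsub>PU_LG G\<^esub> \<in> K" by (rule K.one_closed)
    fix e :: real assume e: "0 < e"
    obtain n where n: "q ^ n < e\<^sup>2" using real_arch_pow_inv[of "e\<^sup>2" q] e q by auto
    obtain w where w: "w \<in> carrier (U_LG G)" "PU_class w \<in> K" "0 < s w" "4 * s w \<le> q ^ Suc n"
      using short by blast
    have "q ^ Suc n \<le> q ^ n" using q by (intro power_decreasing) auto
    then have "2 * s w < e\<^sup>2" using w(3,4) n by linarith
    then have "sqrt (2 * s w) < e" using e by (intro real_less_lsqrt) auto
    moreover have "0 < sqrt (2 * s w)" using w(3) by simp
    ultimately show "\<exists>A\<in>K \<inter> carrier (PU_LG G). 0 < PU_ell_bar G A \<and> PU_ell_bar G A < e"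
      using w(1,2) K.subset
      by (intro bexI[of _ "PU_class w"]) (auto simp: length)
  qed
qed

end

theorem corollary3p4:
  fixes G :: "('a, 'm) monoid_scheme"
  assumes "MIF G"
  shows "(\<forall>u \<in> carrier (PU_LG G). 0 < PU_ell_bar G u \<and> PU_ell_bar G u < 1 / sqrt 2 \<longrightarrow>
            \<not> PU_discrete G (generate (PU_LG G) (insert u (PU_embed G ` carrier G)))) \<and>
         PU_uniformly_discrete G
           {H. subgroup H (PU_LG G) \<and> PU_embed G ` carrier G \<subseteq> H \<and> PU_discrete G H}"
proof -
  interpret group G using assms by (simp add: MIF_def)
  interpret P: group "PU_LG G" by (rule group_PU_LG)
  interpret M: Metric_space "carrier (PU_LG G)" "PU_dist G" by (rule Metric_space_PU)
  have embed: "PU_embed G ` carrier G \<subseteq> carrier (PU_LG G)"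
    by (auto simp: PU_embed_def carrier_PU_LG left_reg_U_LG)
  have "\<not> PU_discrete G (generate (PU_LG G) (insert u (PU_embed G ` carrier G)))"
    if u: "u \<in> carrier (PU_LG G)" "0 < PU_ell_bar G u" "PU_ell_bar G u < 1 / sqrt 2" for u
  proof (rule not_PU_discrete_if_short[OF assms _ _ _ u(2,3)])
    show "subgroup (generate (PU_LG G) (insert u (PU_embed G ` carrier G))) (PU_LG G)"
      using u(1) embed by (intro P.generate_is_subgroup) auto
  qed (auto intro: generate.incl)
  moreover have "PU_uniformly_discrete G
      {H. subgroup H (PU_LG G) \<and> PU_embed G ` carrier G \<subseteq> H \<and> PU_discrete G H}"
    unfolding PU_uniformly_discrete_def
  proof (intro exI conjI ballI)
    let ?U = "M.mball \<one>\<^bsub>PU_LG G\<^esub> (1 / sqrt 2)"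
    show "openin (PU_topology G) ?U" by (simp add: PU_topology_def)
    show one: "\<one>\<^bsub>PU_LG G\<^esub> \<in> ?U" by simp
    fix H assume "H \<in> {H. subgroup H (PU_LG G) \<and> PU_embed G ` carrier G \<subseteq> H \<and> PU_discrete G H}"
    then have H: "subgroup H (PU_LG G)" "PU_embed G ` carrier G \<subseteq> H" "PU_discrete G H" by auto
    have "A = \<one>\<^bsub>PU_LG G\<^esub>" if A: "A \<in> H" "A \<in> ?U" for A
    proof (rule ccontr)
      assume "A \<noteq> \<one>\<^bsub>PU_LG G\<^esub>"
      then have "0 < PU_ell_bar G A" "PU_ell_bar G A < 1 / sqrt 2"
        using A M.mdist_pos_less[of "\<one>\<^bsub>PU_LG G\<^esub>" A] PU_dist_one[of A] by (auto simp: M.in_mball)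
      then show False using not_PU_discrete_if_short[OF assms H(1,2) A(1)] H(3) by blast
    qed
    then show "H \<inter> ?U = {\<one>\<^bsub>PU_LG G\<^esub>}" using one subgroup.one_closed[OF H(1)] by blast
  qed
  ultimately show ?thesis by blast
qed

end
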